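(* Let $\Omega$ be a $\sigma$-compact metric space, $\nu$ a probability measure on its Borel $\sigma$-field, $\mathcal{C}\in\mathbb{C}^{I_1\times\cdots\times I_N\times I_1\times\cdots\times I_N}$ a nonnegative Hermitian tensor and $\tau\mapsto\mathcal{D}_\tau$ a continuous map from $\Omega$ into nonnegative Hermitian tensors of the same size with $\sup_\tau\|\mathcal{D}_\tau\|<\infty$, all of Hermitian rank $r$, and assume $\int_\Omega\|\mathcal{D}_\tau^{-p}\|_\rho\,d\nu(\tau)<\infty$ for any $p>0$. Then the following three statements are equivalent: (i) $\vec\lambda(\mathcal{C})\prec_{\log}\exp\int_{\Omega^r}\log\vec\lambda(\mathcal{D}_\tau)\,d\nu^r(\tau)$; (ii) for every continuous $f:(0,\infty)\to[0,\infty)$ such that $x\mapsto\log f(e^x)$ is convex on $\mathbb{R}$ and every unitarily invariant norm, $\|f(\mathcal{C})\|_\rho\le\exp\int_\Omega\log\|f(\mathcal{D}_\tau)\|_\rho\,d\nu(\tau)$; (iii) for every continuous $g:(0,\infty)\to[0,\infty)$ such that $x\mapsto g(e^x)$ is convex on $\mathbb{R}$ and every unitarily invariant norm, $\|g(\mathcal{C})\|_\rho\le\int_\Omega\|g(\mathcal{D}_\tau)\|_\rho\,d\nu(\tau)$.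
   Context: Einstein product and conjugate transpose over multi-indices as usual; Hermitian tensors decompose as $\mathcal{H}=\sum_{i=1}^r\lambda_i\mathcal{U}_i\otimes\mathcal{U}_i^H$ with real Hermitian eigenvalues and orthonormal $\mathcal{U}_i$, $r$ the Hermitian rank, $\vec\lambda(\mathcal{H})$ the decreasing vector of Hermitian eigenvalues; nonnegative means all Hermitian eigenvalues $\ge0$; functions of Hermitian tensors (including negative powers) act on Hermitian eigenvalues; $|\mathcal{A}|=(\mathcal{A}^H\star_N\mathcal{A})^{1/2}$; $\|\cdot\|$ is the operator norm. Conventions $\log0=-\infty$, $e^{-\infty}=0$; vector operations are componentwise, $\int_{\Omega^r}\log\vec\lambda(\mathcal{D}_\tau)d\nu^r(\tau)=\left(\int_\Omega\log\lambda_i(\mathcal{D}_\tau)d\nu(\tau)\right)_{i=1}^r$. For decreasingly ordered $\mathbf{x},\mathbf{y}\in\mathbb{R}^r_{\ge0}$, $\mathbf{x}\prec_{\log}\mathbf{y}$ means $\prod_{i=1}^kx_i\le\prod_{i=1}^ky_i$ for $k=1,\dots,r$ with equality for $k=r$. A unitarily invariant norm satisfies $\|\mathcal{U}\mathcal{H}\|_\rho=\|\mathcal{H}\mathcal{U}\|_\rho=\|\mathcal{H}\|_\rho$ for unitary $\mathcal{U}$ and $\|\mathcal{H}\|_\rho=\rho(\vec\lambda(|\mathcal{H}|))$ for a symmetric gauge function $\rho$. *)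

theory Defs
  imports "HOL-Probability.Probability"
begin

text \<open>The size is given by the list d = [I_1,...,I_N]; multi-indices are lists of
  naturals. An even-order tensor is a function of two multi-indices, an order-N tensor
  is a function of one multi-index; entries outside the index range are 0.\<close>

type_synonym tensor = "nat list \<Rightarrow> nat list \<Rightarrow> complex"
type_synonym ntensor = "nat list \<Rightarrow> complex"

definition MI :: "nat list \<Rightarrow> nat list set" where
  "MI d = {is. length is = length d \<and> (\<forall>k<length d. is ! k < d ! k)}"

definition einstein :: "nat list \<Rightarrow> tensor \<Rightarrow> tensor \<Rightarrow> tensor" where
  "einstein d A B = (\<lambda>i j. \<Sum>k\<in>MI d. A i k * B k j)"

definition ctrans :: "tensor \<Rightarrow> tensor" where
  "ctrans A = (\<lambda>i j. cnj (A j i))"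

definition is_tensor :: "nat list \<Rightarrow> tensor \<Rightarrow> bool" where
  "is_tensor d A \<longleftrightarrow> (\<forall>i j. (i \<notin> MI d \<or> j \<notin> MI d) \<longrightarrow> A i j = 0)"

definition hermitian :: "nat list \<Rightarrow> tensor \<Rightarrow> bool" where
  "hermitian d H \<longleftrightarrow> is_tensor d H \<and> ctrans H = H"

definition tinner :: "nat list \<Rightarrow> ntensor \<Rightarrow> ntensor \<Rightarrow> complex" where
  "tinner d U V = (\<Sum>i\<in>MI d. U i * cnj (V i))"

definition herm_decomp :: "nat list \<Rightarrow> tensor \<Rightarrow> nat \<Rightarrow> (nat \<Rightarrow> real) \<Rightarrow> (nat \<Rightarrow> ntensor) \<Rightarrow> bool" where
  "herm_decomp d H r lam U \<longleftrightarrow>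
     (\<forall>i<r. \<forall>x. x \<notin> MI d \<longrightarrow> U i x = 0) \<and>
     (\<forall>i<r. \<forall>j<r. tinner d (U i) (U j) = (if i = j then 1 else 0)) \<and>
     H = (\<lambda>a b. \<Sum>i<r. complex_of_real (lam i) * U i a * cnj (U i b))"

definition hermitian_rank :: "nat list \<Rightarrow> tensor \<Rightarrow> nat" where
  "hermitian_rank d H = (LEAST r. \<exists>lam U. herm_decomp d H r lam U)"

definition herm_eigs :: "nat list \<Rightarrow> tensor \<Rightarrow> real list" where
  "herm_eigs d H = (let lam = (SOME lam. \<exists>U. herm_decomp d H (card (MI d)) lam U)
                     in rev (sort (map lam [0..<card (MI d)])))"

definition nonneg_herm :: "nat list \<Rightarrow> tensor \<Rightarrow> bool" where
  "nonneg_herm d H \<longleftrightarrow> hermitian d H \<and> (\<forall>x\<in>set (herm_eigs d H). 0 \<le> x)"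

text \<open>Function of a Hermitian tensor, acting on its (nonzero) Hermitian eigenvalues.
  Zero eigenvalues are sent to 0, so that f only needs to be given on the nonzero
  eigenvalues (e.g. f defined on (0,oo), negative powers).\<close>
definition tfun :: "nat list \<Rightarrow> (real \<Rightarrow> real) \<Rightarrow> tensor \<Rightarrow> tensor" where
  "tfun d f H = (let (lam, U) = (SOME (lam, U). herm_decomp d H (card (MI d)) lam U)
     in (\<lambda>a b. \<Sum>i<card (MI d). (if lam i = 0 then 0 else complex_of_real (f (lam i)))
                                  * U i a * cnj (U i b)))"

definition tabs :: "nat list \<Rightarrow> tensor \<Rightarrow> tensor" where
  "tabs d A = tfun d sqrt (einstein d (ctrans A) A)"

definition tvnorm :: "nat list \<Rightarrow> ntensor \<Rightarrow> real" where
  "tvnorm d x = sqrt (\<Sum>i\<in>MI d. (cmod (x i))\<^sup>2)"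

definition op_norm :: "nat list \<Rightarrow> tensor \<Rightarrow> real" where
  "op_norm d A = Sup {tvnorm d (\<lambda>i. \<Sum>k\<in>MI d. A i k * x k) | x.
                       (\<forall>i. i \<notin> MI d \<longrightarrow> x i = 0) \<and> tvnorm d x \<le> 1}"

definition sym_gauge :: "nat \<Rightarrow> (real list \<Rightarrow> real) \<Rightarrow> bool" where
  "sym_gauge n \<rho> \<longleftrightarrow>
     (\<forall>x. length x = n \<longrightarrow> 0 \<le> \<rho> x) \<and>
     (\<forall>x. length x = n \<longrightarrow> \<rho> x = 0 \<longrightarrow> (\<forall>v\<in>set x. v = 0)) \<and>
     (\<forall>c x. length x = n \<longrightarrow> \<rho> (map (\<lambda>v. c * v) x) = \<bar>c\<bar> * \<rho> x) \<and>
     (\<forall>x y. length x = n \<longrightarrow> length y = n \<longrightarrow> \<rho> (map2 (+) x y) \<le> \<rho> x + \<rho> y) \<and>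
     (\<forall>x y. length x = n \<longrightarrow> mset y = mset x \<longrightarrow> \<rho> y = \<rho> x) \<and>
     (\<forall>x e. length x = n \<longrightarrow> length e = n \<longrightarrow> (\<forall>s\<in>set e. s = 1 \<or> s = -1)
            \<longrightarrow> \<rho> (map2 (*) e x) = \<rho> x)"

definition ui_norm :: "nat list \<Rightarrow> (real list \<Rightarrow> real) \<Rightarrow> tensor \<Rightarrow> real" where
  "ui_norm d \<rho> A = \<rho> (herm_eigs d (tabs d A))"

definition elog :: "real \<Rightarrow> ereal" where
  "elog x = (if x \<le> 0 then -\<infinity> else ereal (ln x))"

definition eexp :: "ereal \<Rightarrow> ereal" where
  "eexp x = (case x of ereal r \<Rightarrow> ereal (exp r) | PInfty \<Rightarrow> \<infinity> | MInfty \<Rightarrow> 0)"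

definition ext_int :: "'a measure \<Rightarrow> ('a \<Rightarrow> ereal) \<Rightarrow> ereal" where
  "ext_int M \<phi> = enn2ereal (\<integral>\<^sup>+x. e2ennreal (\<phi> x) \<partial>M)
                  - enn2ereal (\<integral>\<^sup>+x. e2ennreal (- \<phi> x) \<partial>M)"

definition log_exp_convex :: "(real \<Rightarrow> real) \<Rightarrow> bool" where
  "log_exp_convex f \<longleftrightarrow>
     (\<forall>x y t. 0 < t \<and> t < 1 \<longrightarrow>
        elog (f (exp (t * x + (1 - t) * y))) \<le> ereal t * elog (f (exp x)) + ereal (1 - t) * elog (f (exp y)))"

definition sigma_compact_space :: "'a::topological_space itself \<Rightarrow> bool" where
  "sigma_compact_space _ \<longleftrightarrow> (\<exists>K :: nat \<Rightarrow> 'a set. (\<forall>n. compact (K n)) \<and> (\<Union>n. K n) = UNIV)"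

end

theory Submission
  imports Defs
begin

text \<open>Let \<open>\<Phi>(x)\<close> be \<open>log (\<rho>(f(e\<^sup>x)))\<close> or \<open>\<rho>(g(e\<^sup>x))\<close>, a symmetric convex function of \<open>x \<in> \<real>\<^sup>r\<close>. By symmetry a
  subgradient at \<open>x = log \<lambda>(C)\<close> may be rearranged decreasingly, and Abel summation against the
  log-majorization (i) gives an affine minorant of \<open>\<Phi>\<close> which takes a value at least \<open>\<Phi>(x)\<close> at
  \<open>L = \<integral> log \<lambda>(D\<^sub>\<tau>) d\<nu>\<close>. Integrating this minorant along \<open>log \<lambda>(D\<^sub>\<tau>)\<close> yields (ii) and (iii) at once.

  Conversely, (ii) and (iii) for \<open>x\<^sup>p\<close> and Ky Fan norms give
  \<open>\<Sum>\<^sub>i (\<lambda>\<^sub>i(C)\<^sup>p - 1) / p \<le> \<integral> \<Sum>\<^sub>i (\<lambda>\<^sub>i(D\<^sub>\<tau>)\<^sup>p - 1) / p d\<nu>\<close>, and \<open>p \<rightarrow> 0\<close> turns both sides into logarithms by dominated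
  convergence; negative \<open>p\<close> and the trace norm give the equality for \<open>k = r\<close>.\<close>

section \<open>Orthonormal systems and the spectral theorem\<close>

text \<open>The argument itself concerns positive decreasing sequences only. Eigenvalue lists and
  functions of a tensor are, however, defined through an arbitrarily chosen decomposition, so the
  spectral theorem and the uniqueness of the spectrum are needed before anything can be said about
  them. The common rank r then puts the positive eigenvalues of \<open>C\<close> and of every
  \<open>D \<tau>\<close> in the same r places, and no logarithm meets a zero eigenvalue.

  The analytic obstacle is measurability: nothing is known about \<Phi> along the spectra of
  \<open>D \<tau>\<close>. The subgradient is taken once, at \<open>C\<close>, and not for each
  \<tau>; the minorant is thus a fixed affine combination of log eigenvalues, measurable because
  eigenvalues depend continuously on the tensor. These logarithms are integrable since the norm
  bound controls large eigenvalues and the inverse powers control small ones.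

  In the converse, (ii) is first weakened by Jensen to an inequality of type (iii). A negative power
  reverses the order of the eigenvalues, so its Ky Fan sums see the wrong end of the spectrum unless
  k = r; this is why it yields an inequality for the full product only.\<close>

definition orthonormal :: "nat list \<Rightarrow> nat \<Rightarrow> (nat \<Rightarrow> ntensor) \<Rightarrow> bool" where
  "orthonormal d r U \<longleftrightarrow>
     (\<forall>i<r. \<forall>x. x \<notin> MI d \<longrightarrow> U i x = 0) \<and>
     (\<forall>i<r. \<forall>j<r. tinner d (U i) (U j) = (if i = j then 1 else 0))"

definition tapply :: "nat list \<Rightarrow> tensor \<Rightarrow> ntensor \<Rightarrow> ntensor" where
  "tapply d A v = (\<lambda>a. \<Sum>b\<in>MI d. A a b * v b)"

lemma herm_decomp_altdef:
  "herm_decomp d H r lam U \<longleftrightarrow>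
     orthonormal d r U \<and> H = (\<lambda>a b. \<Sum>i<r. complex_of_real (lam i) * U i a * cnj (U i b))"
  by (simp add: herm_decomp_def orthonormal_def)

lemma orthonormalD:
  assumes "orthonormal d r U"
  shows "i < r \<Longrightarrow> x \<notin> MI d \<Longrightarrow> U i x = 0"
    and "i < r \<Longrightarrow> j < r \<Longrightarrow> tinner d (U i) (U j) = (if i = j then 1 else 0)"
  using assms by (auto simp: orthonormal_def)

lemma finite_MI [simp]: "finite (MI d)"
proof (rule finite_subset)
  show "MI d \<subseteq> {xs. set xs \<subseteq> {..<Suc (Max (set d))} \<and> length xs = length d}"
  proof
    fix xs assume xs: "xs \<in> MI d"
    then have len: "length xs = length d" and lt: "\<And>k. k < length d \<Longrightarrow> xs ! k < d ! k"
      by (auto simp: MI_def)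
    have "xs ! k < Suc (Max (set d))" if "k < length d" for k
    proof -
      have "d ! k \<le> Max (set d)" using that by (intro Max_ge) auto
      then show ?thesis using lt[OF that] by linarith
    qed
    with len show "xs \<in> {xs. set xs \<subseteq> {..<Suc (Max (set d))} \<and> length xs = length d}"
      by (auto simp: in_set_conv_nth)
  qed
  show "finite {xs. set xs \<subseteq> {..<Suc (Max (set d))} \<and> length xs = length d}"
    by (rule finite_lists_length_eq) simp
qed

lemma tinner_cnj: "cnj (tinner d U V) = tinner d V U"
  by (simp add: tinner_def mult.commute)

lemma tinner_self: "tinner d v v = of_real (\<Sum>a\<in>MI d. (cmod (v a))\<^sup>2)"
  by (simp add: tinner_def complex_norm_square flip: of_real_power)

lemma tinner_self_Re: "tinner d v v = of_real (Re (tinner d v v))"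
  by (simp add: tinner_self)

lemma tinner_self_nonneg: "0 \<le> Re (tinner d v v)"
  by (simp add: tinner_self sum_nonneg)

lemma tinner_self_zero: "Re (tinner d v v) = 0 \<Longrightarrow> a \<in> MI d \<Longrightarrow> v a = 0"
  by (simp add: tinner_self sum_nonneg_eq_0_iff)

lemma tinner_diff_left: "tinner d (\<lambda>a. u a - v a) w = tinner d u w - tinner d v w"
  by (simp add: tinner_def algebra_simps sum_subtractf)

lemma tinner_diff_right: "tinner d w (\<lambda>a. u a - v a) = tinner d w u - tinner d w v"
  by (simp add: tinner_def algebra_simps sum_subtractf)

lemma tinner_scale_left: "tinner d (\<lambda>a. c * u a) w = c * tinner d u w"
  by (simp add: tinner_def sum_distrib_left mult.assoc)

lemma tinner_scale_right: "tinner d w (\<lambda>a. c * u a) = cnj c * tinner d w u"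
  by (simp add: tinner_def sum_distrib_left algebra_simps)

lemma tinner_sum_left: "tinner d (\<lambda>a. \<Sum>i\<in>I. u i a) w = (\<Sum>i\<in>I. tinner d (u i) w)"
  unfolding tinner_def sum_distrib_right by (rule sum.swap)

lemma tinner_sum_right: "tinner d w (\<lambda>a. \<Sum>i\<in>I. u i a) = (\<Sum>i\<in>I. tinner d w (u i))"
  unfolding tinner_def cnj_sum sum_distrib_left by (rule sum.swap)

lemma tinner_lincomb_left:
  assumes U: "orthonormal d r U" and "j < r"
  shows "tinner d (\<lambda>a. \<Sum>i<r. c i * U i a) (U j) = c j"
proof -
  have "tinner d (\<lambda>a. \<Sum>i<r. c i * U i a) (U j) = (\<Sum>i<r. c i * (if i = j then 1 else 0))"
    unfolding tinner_sum_left tinner_scale_left using orthonormalD(2)[OF U] \<open>j < r\<close>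
    by (intro sum.cong) auto
  then show ?thesis using \<open>j < r\<close> by (simp add: if_distrib cong: if_cong)
qed

section \<open>Orthogonal projection, Bessel and Parseval\<close>

definition residual :: "nat list \<Rightarrow> nat \<Rightarrow> (nat \<Rightarrow> ntensor) \<Rightarrow> ntensor \<Rightarrow> ntensor" where
  "residual d r U v = (\<lambda>a. v a - (\<Sum>i<r. tinner d v (U i) * U i a))"

lemma residual_orth:
  assumes "orthonormal d r U" "j < r"
  shows "tinner d (residual d r U v) (U j) = 0"
  unfolding residual_def tinner_diff_left tinner_lincomb_left[OF assms] by simp

lemma residual_norm:
  assumes "orthonormal d r U"
  shows "Re (tinner d (residual d r U v) (residual d r U v))
           = Re (tinner d v v) - (\<Sum>i<r. (cmod (tinner d v (U i)))\<^sup>2)"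
proof -
  let ?w = "residual d r U v"
  have "tinner d ?w ?w = tinner d ?w v - (\<Sum>i<r. cnj (tinner d v (U i)) * tinner d ?w (U i))"
    unfolding tinner_scale_right[symmetric] tinner_sum_right[symmetric] tinner_diff_right[symmetric]
    by (simp add: residual_def)
  also have "\<dots> = tinner d ?w v" using residual_orth[OF assms] by simp
  also have "\<dots> = tinner d v v - (\<Sum>i<r. tinner d v (U i) * tinner d (U i) v)"
    unfolding residual_def tinner_diff_left tinner_sum_left tinner_scale_left ..
  also have "(\<Sum>i<r. tinner d v (U i) * tinner d (U i) v)
             = of_real (\<Sum>i<r. (cmod (tinner d v (U i)))\<^sup>2)"
    unfolding of_real_sum
    by (intro sum.cong refl) (metis complex_norm_square tinner_cnj)
  finally show ?thesis by simp
qed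

lemma bessel:
  assumes "orthonormal d r U"
  shows "(\<Sum>i<r. (cmod (tinner d v (U i)))\<^sup>2) \<le> Re (tinner d v v)"
  using residual_norm[OF assms, of v] tinner_self_nonneg[of d "residual d r U v"] by simp

definition tunit :: "nat list \<Rightarrow> ntensor" where
  "tunit a = (\<lambda>x. if x = a then 1 else 0)"

lemma tunit_same [simp]: "tunit a a = 1"
  by (simp add: tunit_def)

lemma tinner_tunit: "a \<in> MI d \<Longrightarrow> tinner d (tunit a) v = cnj (v a)"
  by (simp add: tinner_def tunit_def if_distrib[of "\<lambda>x. x * _"] cong: if_cong)

lemma tinner_tunit_self: "a \<in> MI d \<Longrightarrow> tinner d (tunit a) (tunit a) = 1"
  by (simp add: tinner_tunit)

text \<open>This double count stands in for dimension theory: it forces completeness when r is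
  \<open>card (MI d)\<close>, and leaves some coordinate with squared sum below 1 when r is
  smaller.\<close>

lemma orthonormal_sum_norms:
  assumes "orthonormal d r U"
  shows "(\<Sum>a\<in>MI d. \<Sum>i<r. (cmod (U i a))\<^sup>2) = real r"
proof -
  have "(\<Sum>a\<in>MI d. \<Sum>i<r. (cmod (U i a))\<^sup>2) = (\<Sum>i<r. Re (tinner d (U i) (U i)))"
    by (subst sum.swap) (simp add: tinner_self)
  also have "\<dots> = (\<Sum>i<r. 1)" using orthonormalD(2)[OF assms] by simp
  finally show ?thesis by simp
qed

lemma orthonormal_coord_le:
  assumes "orthonormal d r U" "a \<in> MI d"
  shows "(\<Sum>i<r. (cmod (U i a))\<^sup>2) \<le> 1"
  using bessel[OF assms(1), of "tunit a"] assms(2) by (simp add: tinner_tunit tinner_tunit_self)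

text \<open>The column sums of squares of \<^term>\<open>card (MI d)\<close> orthonormal vectors are at most 1 by Bessel
  and add up to \<^term>\<open>card (MI d)\<close>; so Bessel is an equality on unit vectors.\<close>

lemma orthonormal_complete:
  assumes U: "orthonormal d (card (MI d)) U" and a: "a \<in> MI d" and b: "b \<in> MI d"
  shows "(\<Sum>i<card (MI d). U i b * cnj (U i a)) = (if b = a then 1 else 0)"
proof -
  let ?n = "card (MI d)"
  have "(\<Sum>a\<in>MI d. 1 - (\<Sum>i<?n. (cmod (U i a))\<^sup>2)) = 0"
    using orthonormal_sum_norms[OF U] by (simp add: sum_subtractf)
  then have "1 - (\<Sum>i<?n. (cmod (U i a))\<^sup>2) = 0"
    by (subst (asm) sum_nonneg_eq_0_iff) (use a orthonormal_coord_le[OF U] in auto)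
  then have "Re (tinner d (residual d ?n U (tunit a)) (residual d ?n U (tunit a))) = 0"
    unfolding residual_norm[OF U] using a by (simp add: tinner_tunit tinner_tunit_self)
  from tinner_self_zero[OF this b] show ?thesis using a
    by (simp add: residual_def tinner_tunit mult.commute) (simp add: tunit_def split: if_splits)
qed

lemma parseval:
  assumes U: "orthonormal d (card (MI d)) U"
  shows "(\<Sum>i<card (MI d). (cmod (tinner d v (U i)))\<^sup>2) = Re (tinner d v v)"
proof -
  let ?n = "card (MI d)"
  have "complex_of_real (\<Sum>i<?n. (cmod (tinner d v (U i)))\<^sup>2)
      = (\<Sum>i<?n. \<Sum>a\<in>MI d. \<Sum>b\<in>MI d. v a * cnj (v b) * (U i b * cnj (U i a)))"
    unfolding of_real_sum complex_norm_square tinner_cnj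
    by (simp add: tinner_def sum_product algebra_simps)
  also have "\<dots> = (\<Sum>a\<in>MI d. \<Sum>b\<in>MI d. \<Sum>i<?n. v a * cnj (v b) * (U i b * cnj (U i a)))"
    by (subst sum.swap, rule sum.cong[OF refl], rule sum.swap)
  also have "\<dots> = (\<Sum>a\<in>MI d. \<Sum>b\<in>MI d. v a * cnj (v b) * (if b = a then 1 else 0))"
    unfolding sum_distrib_left[symmetric] using orthonormal_complete[OF U]
    by (intro sum.cong refl) auto
  also have "\<dots> = (\<Sum>a\<in>MI d. v a * cnj (v a))"
    by (intro sum.cong refl) (simp add: if_distrib cong: if_cong)
  finally have "complex_of_real (\<Sum>i<?n. (cmod (tinner d v (U i)))\<^sup>2) = tinner d v v"
    by (simp only: tinner_def)
  then show ?thesis by (metis Re_complex_of_real)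
qed

text \<open>By the double count some column has squared sum below 1. The unit vector of that
  coordinate then has a nonzero residual, which only has to be normalised.\<close>

lemma orthonormal_extend_exists:
  assumes U: "orthonormal d k U" and k: "k < card (MI d)"
  obtains v where "\<And>a. a \<notin> MI d \<Longrightarrow> v a = 0" "tinner d v v = 1" "\<And>i. i < k \<Longrightarrow> tinner d v (U i) = 0"
proof -
  have "\<exists>a\<in>MI d. (\<Sum>i<k. (cmod (U i a))\<^sup>2) < 1"
  proof (rule ccontr)
    assume "\<not> ?thesis"
    then have "(\<Sum>a\<in>MI d. 1) \<le> (\<Sum>a\<in>MI d. \<Sum>i<k. (cmod (U i a))\<^sup>2)"
      by (intro sum_mono) (auto simp: not_less)
    then show False using orthonormal_sum_norms[OF U] k by simp
  qed
  then obtain a where a: "a \<in> MI d" and lt: "(\<Sum>i<k. (cmod (U i a))\<^sup>2) < 1" by blast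
  define w where "w = residual d k U (tunit a)"
  define s where "s = Re (tinner d w w)"
  have s: "s > 0"
    unfolding s_def w_def residual_norm[OF U] using a lt by (simp add: tinner_tunit tinner_tunit_self)
  define v where "v = (\<lambda>x. complex_of_real (1 / sqrt s) * w x)"
  show thesis
  proof (rule that[of v])
    show "v x = 0" if "x \<notin> MI d" for x
    proof -
      have "x \<noteq> a" using a that by auto
      then show ?thesis
        using that orthonormalD(1)[OF U] by (simp add: v_def w_def residual_def tunit_def)
    qed
    have "tinner d v v = complex_of_real (1 / sqrt s) * (complex_of_real (1 / sqrt s) * tinner d w w)"
      unfolding v_def tinner_scale_left tinner_scale_right by simp
    also have "tinner d w w = complex_of_real s"
      unfolding s_def by (rule tinner_self_Re)
    also have "complex_of_real (1 / sqrt s) * (complex_of_real (1 / sqrt s) * complex_of_real s)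
        = complex_of_real (1 / sqrt s * (1 / sqrt s * s))"
      by (simp only: of_real_mult)
    also have "1 / sqrt s * (1 / sqrt s * s) = 1" using s by (simp add: field_simps)
    also have "complex_of_real 1 = 1" by simp
    finally show "tinner d v v = 1" .
    show "tinner d v (U i) = 0" if "i < k" for i
      unfolding v_def tinner_scale_left w_def residual_orth[OF U that] by simp
  qed
qed

section \<open>The spectral theorem\<close>

lemma hermitianD:
  assumes "hermitian d H"
  shows "cnj (H b a) = H a b" "a \<notin> MI d \<Longrightarrow> H a b = 0" "b \<notin> MI d \<Longrightarrow> H a b = 0"
  using assms by (auto simp: hermitian_def is_tensor_def ctrans_def fun_eq_iff)

lemma tinner_tapply_herm:
  assumes "hermitian d H"
  shows "tinner d (tapply d H u) v = tinner d u (tapply d H v)"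
proof -
  have "tinner d (tapply d H u) v = (\<Sum>a\<in>MI d. \<Sum>b\<in>MI d. H a b * u b * cnj (v a))"
    by (simp add: tinner_def tapply_def sum_distrib_right)
  also have "\<dots> = (\<Sum>b\<in>MI d. \<Sum>a\<in>MI d. H a b * u b * cnj (v a))"
    by (rule sum.swap)
  also have "\<dots> = tinner d u (tapply d H v)"
    by (simp add: tinner_def tapply_def sum_distrib_left hermitianD(1)[OF assms] algebra_simps)
  finally show ?thesis .
qed

lemma tapply_scale: "tapply d H (\<lambda>a. c * u a) = (\<lambda>a. c * tapply d H u a)"
  by (simp add: tapply_def sum_distrib_left algebra_simps)

lemma tapply_diff: "tapply d H (\<lambda>a. u a - v a) = (\<lambda>a. tapply d H u a - tapply d H v a)"
  by (simp add: tapply_def sum_subtractf algebra_simps)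

lemma continuous_on_coord: "continuous_on S (\<lambda>v. v x :: complex)"
  by (rule continuous_on_product_then_coordinatewise[OF continuous_on_id])

text \<open>Vectors are functions on all of \<open>nat list\<close>, with the product topology.
  Tychonoff applies to the product of unit discs over the index range and of the point 0 elsewhere,
  and the sphere is a closed part of it.\<close>

lemma compact_unit_sphere:
  "compact {v. (\<forall>x. x \<notin> MI d \<longrightarrow> v x = 0) \<and> tinner d v v = 1 \<and> (\<forall>i<k. tinner d v (U i) = 0)}"
    (is "compact ?K")
proof -
  let ?P = "PiE UNIV (\<lambda>x. if x \<in> MI d then cball 0 1 else {0}) :: ntensor set"
  have "compactin (product_topology (\<lambda>_. euclidean) UNIV) ?P"
    unfolding compactin_PiE by auto
  then have P: "compact ?P"
    by (simp add: euclidean_product_topology)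
  have "closed ({v. tinner d v v = 1} \<inter> (\<Inter>i\<in>{..<k}. {v. tinner d v (U i) = 0}))"
    unfolding tinner_def
    by (intro closed_Int closed_INT ballI closed_Collect_eq continuous_intros continuous_on_coord)
  from compact_Int_closed[OF P this]
  have c: "compact (?P \<inter> ({v. tinner d v v = 1} \<inter> (\<Inter>i\<in>{..<k}. {v. tinner d v (U i) = 0})))" .
  have "cmod (v x) \<le> 1" if "tinner d v v = 1" "x \<in> MI d" for v x
  proof -
    have "(cmod (v x))\<^sup>2 \<le> (\<Sum>a\<in>MI d. (cmod (v a))\<^sup>2)"
      using that(2) by (intro member_le_sum) auto
    also have "\<dots> = 1" using that(1) unfolding tinner_self by (simp only: of_real_eq_1_iff)
    finally show ?thesis by (simp add: power2_le_imp_le abs_square_le_1)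
  qed
  then have "?K = ?P \<inter> ({v. tinner d v v = 1} \<inter> (\<Inter>i\<in>{..<k}. {v. tinner d v (U i) = 0}))"
    by (auto simp: PiE_iff split: if_splits)
  with c show ?thesis by simp
qed

text \<open>A maximiser of the quadratic form on the unit sphere of the orthogonal complement is an
  eigenvector.\<close>

lemma eigenvector_orth_exists:
  assumes H: "hermitian d H" and U: "orthonormal d k U" and k: "k < card (MI d)"
    and eig: "\<And>i. i < k \<Longrightarrow> tapply d H (U i) = (\<lambda>a. complex_of_real (lam i) * U i a)"
  obtains v l where "\<And>a. a \<notin> MI d \<Longrightarrow> v a = 0" "tinner d v v = 1" "\<And>i. i < k \<Longrightarrow> tinner d v (U i) = 0"
    "tapply d H v = (\<lambda>a. complex_of_real l * v a)"
proof -
  define W where "W = {v. (\<forall>x. x \<notin> MI d \<longrightarrow> v x = 0) \<and> (\<forall>i<k. tinner d v (U i) = 0)}"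
  define K where "K = {v. (\<forall>x. x \<notin> MI d \<longrightarrow> v x = 0) \<and> tinner d v v = 1 \<and> (\<forall>i<k. tinner d v (U i) = 0)}"
  define q where "q v = Re (tinner d (tapply d H v) v)" for v
  obtain v0 where "v0 \<in> K"
    using orthonormal_extend_exists[OF U k] unfolding K_def mem_Collect_eq by metis
  then have "K \<noteq> {}" by auto
  moreover have "continuous_on K q"
    unfolding q_def tinner_def tapply_def by (intro continuous_intros continuous_on_coord)
  ultimately obtain v where v: "v \<in> K" and max: "\<And>u. u \<in> K \<Longrightarrow> q u \<le> q v"
    using continuous_attains_sup[OF compact_unit_sphere[of d k U, folded K_def]] by blast
  have vW: "v \<in> W" and vv: "tinner d v v = 1" using v by (auto simp: W_def K_def)
  define l where "l = q v"
  \<comment> \<open>Both sides scale quadratically, so maximality on the sphere extends to the whole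
    subspace.\<close>
  have bound: "q u \<le> l * Re (tinner d u u)" if u: "u \<in> W" for u
  proof (cases "Re (tinner d u u) = 0")
    case True
    then have "u a = 0" if "a \<in> MI d" for a using that by (rule tinner_self_zero)
    then have "q u = 0" by (simp add: q_def tinner_def)
    with True show ?thesis by simp
  next
    case False
    define s where "s = Re (tinner d u u)"
    have s: "s > 0" using False tinner_self_nonneg[of d u] by (simp add: s_def)
    define c where "c = complex_of_real (1 / sqrt s)"
    have cc: "c * cnj c = complex_of_real (1 / s)"
      using s by (simp add: c_def flip: of_real_mult)
    have us: "tinner d u u = complex_of_real s" unfolding s_def by (rule tinner_self_Re)
    have "tinner d (\<lambda>a. c * u a) (\<lambda>a. c * u a) = (c * cnj c) * tinner d u u"
      by (simp add: tinner_scale_left tinner_scale_right)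
    also have "\<dots> = 1" unfolding cc us using s by simp
    finally have "(\<lambda>a. c * u a) \<in> K"
      using u by (auto simp: K_def W_def tinner_scale_left)
    then have "q (\<lambda>a. c * u a) \<le> l" unfolding l_def by (rule max)
    moreover have "tinner d (tapply d H (\<lambda>a. c * u a)) (\<lambda>a. c * u a)
        = (c * cnj c) * tinner d (tapply d H u) u"
      by (simp add: tapply_scale tinner_scale_left tinner_scale_right)
    ultimately have "1 / s * q u \<le> l"
      unfolding q_def cc by simp
    then show ?thesis using s by (simp add: s_def[symmetric] field_simps)
  qed
  \<comment> \<open>B is l - H. Its form is nonnegative on \<open>W\<close> and vanishes at v; it
    remains to see that such a zero lies in the kernel, by moving v in the direction
    \<open>B v\<close>.\<close>
  define B where "B u = (\<lambda>a. complex_of_real l * u a - tapply d H u a)" for u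
  have Bpos: "0 \<le> Re (tinner d (B u) u)" if "u \<in> W" for u
    using bound[OF that] by (simp add: B_def tinner_diff_left tinner_scale_left q_def)
  define w where "w = B v"
  have "tinner d w (U i) = 0" if "i < k" for i
    using that vW by (simp add: w_def B_def W_def tinner_diff_left tinner_scale_left
        tinner_tapply_herm[OF H] eig tinner_scale_right)
  moreover have "w x = 0" if "x \<notin> MI d" for x
    using that vW hermitianD(2)[OF H that] by (simp add: w_def B_def W_def tapply_def)
  ultimately have wW: "w \<in> W" by (simp add: W_def)
  have Bsym: "tinner d (B u) u' = tinner d u (B u')" for u u'
    by (simp add: B_def tinner_diff_left tinner_diff_right tinner_scale_left tinner_scale_right
        tinner_tapply_herm[OF H])
  have Bv: "Re (tinner d (B v) v) = 0"
    by (simp add: B_def tinner_diff_left tinner_scale_left vv l_def q_def)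
  define N M where "N = Re (tinner d w w)" and "M = Re (tinner d (B w) w)"
  \<comment> \<open>Nonnegativity of the form at v - t w, where the term of order 0 in t
    vanishes.\<close>
  have ineq: "2 * t * N \<le> t * t * M" if "t > 0" for t :: real
  proof -
    define u where "u = (\<lambda>a. v a - complex_of_real t * w a)"
    have uW: "u \<in> W" using vW wW
      by (simp add: W_def u_def tinner_diff_left tinner_scale_left)
    have "B u = (\<lambda>a. B v a - complex_of_real t * B w a)"
      by (simp add: B_def u_def tapply_diff tapply_scale algebra_simps)
    then have "tinner d (B u) u = tinner d (B v) v - complex_of_real t * tinner d (B v) w
       - complex_of_real t * tinner d (B w) v + complex_of_real (t * t) * tinner d (B w) w"
      by (simp add: u_def tinner_diff_left tinner_scale_left tinner_diff_right tinner_scale_right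
          algebra_simps)
    then have "Re (tinner d (B u) u) = - t * N - t * N + t * t * M"
      using Bv[folded w_def] by (simp add: Bsym[of w v] w_def[symmetric] N_def M_def)
    with Bpos[OF uW] show ?thesis by (simp add: algebra_simps)
  qed
  have "N = 0"
  proof (rule ccontr)
    assume "N \<noteq> 0"
    then have N: "N > 0" using tinner_self_nonneg[of d w] by (simp add: N_def)
    \<comment> \<open>Small enough that t M is at most N, which contradicts 2 N \<le> t M.\<close>
    define t where "t = N / (\<bar>M\<bar> + 1)"
    have t: "t > 0" using N by (simp add: t_def)
    have "t * (2 * N) \<le> t * (t * M)" using ineq[OF t] by (simp add: algebra_simps)
    then have "2 * N \<le> t * M" using t by (metis mult_le_cancel_left_pos)
    also have "\<dots> \<le> t * (\<bar>M\<bar> + 1)" using t by (intro mult_left_mono) auto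
    also have "\<dots> = N" by (simp add: t_def)
    finally show False using N by simp
  qed
  then have "w a = 0" for a
    using tinner_self_zero[of d w a] wW by (cases "a \<in> MI d") (auto simp: N_def W_def)
  then have "tapply d H v = (\<lambda>a. complex_of_real l * v a)"
    by (simp add: w_def B_def fun_eq_iff)
  with vW vv show thesis by (intro that[of v l]) (auto simp: W_def)
qed

lemma eigenbasis_exists:
  assumes H: "hermitian d H" and "k \<le> card (MI d)"
  shows "\<exists>lam U. orthonormal d k U \<and> (\<forall>i<k. tapply d H (U i) = (\<lambda>a. complex_of_real (lam i) * U i a))"
  using \<open>k \<le> card (MI d)\<close>
proof (induction k)
  case 0
  show ?case by (simp add: orthonormal_def)
next
  case (Suc k)
  then obtain lam U where U: "orthonormal d k U"
    and eig: "\<And>i. i < k \<Longrightarrow> tapply d H (U i) = (\<lambda>a. complex_of_real (lam i) * U i a)"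
    by auto
  obtain v l where v: "\<And>a. a \<notin> MI d \<Longrightarrow> v a = 0" "tinner d v v = 1"
      "\<And>i. i < k \<Longrightarrow> tinner d v (U i) = 0" "tapply d H v = (\<lambda>a. complex_of_real l * v a)"
    using eigenvector_orth_exists[OF H U _ eig] Suc.prems by (metis Suc_le_lessD)
  have v': "tinner d (U i) v = 0" if "i < k" for i
    using v(3)[OF that] tinner_cnj[of d v "U i"] by simp
  have "orthonormal d (Suc k) (U(k := v))"
    using U v v' by (auto simp: orthonormal_def less_Suc_eq)
  moreover have "\<forall>i<Suc k. tapply d H ((U(k := v)) i)
      = (\<lambda>a. complex_of_real ((lam(k := l)) i) * (U(k := v)) i a)"
    using eig v(4) by (simp add: less_Suc_eq)
  ultimately show ?case by blast
qed

theorem herm_decomp_exists: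
  assumes H: "hermitian d H"
  shows "\<exists>lam U. herm_decomp d H (card (MI d)) lam U"
proof -
  let ?n = "card (MI d)"
  obtain lam U where U: "orthonormal d ?n U"
    and eig: "\<And>i. i < ?n \<Longrightarrow> tapply d H (U i) = (\<lambda>a. complex_of_real (lam i) * U i a)"
    using eigenbasis_exists[OF H order_refl] by blast
  have "H a b = (\<Sum>i<?n. complex_of_real (lam i) * U i a * cnj (U i b))" for a b
  proof (cases "b \<in> MI d")
    case True
    \<comment> \<open>Inserting the resolution of the identity given by completeness of the
      eigenbasis.\<close>
    have "H a b = (\<Sum>c\<in>MI d. H a c * (if c = b then 1 else 0))"
      using True by (simp add: if_distrib cong: if_cong)
    also have "\<dots> = (\<Sum>c\<in>MI d. H a c * (\<Sum>i<?n. U i c * cnj (U i b)))"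
      using orthonormal_complete[OF U True] by (intro sum.cong refl) auto
    also have "\<dots> = (\<Sum>i<?n. tapply d H (U i) a * cnj (U i b))"
      unfolding tapply_def sum_distrib_left sum_distrib_right
      by (subst sum.swap) (simp add: mult.assoc)
    also have "\<dots> = (\<Sum>i<?n. complex_of_real (lam i) * U i a * cnj (U i b))"
      using eig by simp
    finally show ?thesis .
  next
    case False
    then show ?thesis using hermitianD(3)[OF H False] orthonormalD(1)[OF U] by simp
  qed
  with U show ?thesis unfolding herm_decomp_altdef by blast
qed

section \<open>Hermitian eigenvalues\<close>

lemma tapply_decomp:
  assumes "herm_decomp d H r lam U"
  shows "tapply d H v = (\<lambda>a. \<Sum>i<r. complex_of_real (lam i) * tinner d v (U i) * U i a)"
proof
  fix a
  have H: "H = (\<lambda>a b. \<Sum>i<r. complex_of_real (lam i) * U i a * cnj (U i b))"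
    using assms by (simp add: herm_decomp_altdef)
  have "tapply d H v a = (\<Sum>b\<in>MI d. \<Sum>i<r. complex_of_real (lam i) * U i a * cnj (U i b) * v b)"
    by (simp add: tapply_def H sum_distrib_right)
  also have "\<dots> = (\<Sum>i<r. \<Sum>b\<in>MI d. complex_of_real (lam i) * U i a * cnj (U i b) * v b)"
    by (rule sum.swap)
  also have "\<dots> = (\<Sum>i<r. complex_of_real (lam i) * tinner d v (U i) * U i a)"
    unfolding tinner_def sum_distrib_left sum_distrib_right by (simp add: algebra_simps)
  finally show "tapply d H v a = \<dots>" .
qed

lemma herm_decomp_orthonormal: "herm_decomp d H r lam U \<Longrightarrow> orthonormal d r U"
  by (simp add: herm_decomp_altdef)

lemma tapply_eigenvector:
  assumes "herm_decomp d H r lam U" "j < r"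
  shows "tapply d H (U j) = (\<lambda>a. complex_of_real (lam j) * U j a)"
proof
  fix a
  have "tapply d H (U j) a
      = (\<Sum>i<r. if j = i then complex_of_real (lam i) * U i a else 0)"
    unfolding tapply_decomp[OF assms(1)]
    using orthonormalD(2)[OF herm_decomp_orthonormal[OF assms(1)] assms(2)]
    by (intro sum.cong) auto
  then show "tapply d H (U j) a = complex_of_real (lam j) * U j a"
    using assms(2) by simp
qed

lemma herm_decomp_hermitian:
  assumes "herm_decomp d H r lam U"
  shows "hermitian d H"
  using assms unfolding herm_decomp_altdef
  by (auto simp: hermitian_def is_tensor_def ctrans_def orthonormal_def fun_eq_iff algebra_simps
      intro!: sum.neutral)

text \<open>Moving \<open>H\<close> across the inner product multiplies the overlap by one
  eigenvalue or by the other, both being real.\<close>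

lemma herm_decomp_overlap:
  assumes "herm_decomp d H r lam U" "herm_decomp d H s mu V" "i < r" "j < s" "lam i \<noteq> mu j"
  shows "tinner d (U i) (V j) = 0"
proof -
  have "complex_of_real (lam i) * tinner d (U i) (V j) = complex_of_real (mu j) * tinner d (U i) (V j)"
    using tinner_tapply_herm[OF herm_decomp_hermitian[OF assms(1)], of "U i" "V j"]
    unfolding tapply_eigenvector[OF assms(1,3)] tapply_eigenvector[OF assms(2,4)]
    by (simp add: tinner_scale_left tinner_scale_right)
  with assms(5) show ?thesis by simp
qed

lemma cmod_tinner_commute: "cmod (tinner d u v) = cmod (tinner d v u)"
  using tinner_cnj[of d u v] by (metis complex_mod_cnj)

text \<open>The squared overlaps of two eigenbases form a doubly stochastic matrix supported on pairs of
  equal eigenvalues.\<close>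

lemma herm_decomp_unique:
  assumes U: "herm_decomp d H (card (MI d)) lam U" and V: "herm_decomp d H (card (MI d)) mu V"
  shows "image_mset lam (mset_set {..<card (MI d)}) = image_mset mu (mset_set {..<card (MI d)})"
proof (rule multiset_eqI)
  fix x
  let ?n = "card (MI d)"
  let ?w = "\<lambda>i j. (cmod (tinner d (U i) (V j)))\<^sup>2"
  have row: "(\<Sum>j<?n. ?w i j) = 1" if "i < ?n" for i
    using parseval[OF herm_decomp_orthonormal[OF V], of "U i"]
      orthonormalD(2)[OF herm_decomp_orthonormal[OF U] that that] by simp
  have col: "(\<Sum>i<?n. ?w i j) = 1" if "j < ?n" for j
    using parseval[OF herm_decomp_orthonormal[OF U], of "V j"]
      orthonormalD(2)[OF herm_decomp_orthonormal[OF V] that that]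
    by (simp add: cmod_tinner_commute)
  have cnt: "real (count (image_mset l (mset_set {..<?n})) x) = (\<Sum>i<?n. if l i = x then 1 else 0)"
    for l :: "nat \<Rightarrow> real"
    by (simp add: count_image_mset sum.If_cases Int_def vimage_def conj_commute)
  have "(\<Sum>i<?n. if lam i = x then 1 else 0) = (\<Sum>i<?n. if lam i = x then \<Sum>j<?n. ?w i j else 0)"
    using row by (intro sum.cong) auto
  also have "\<dots> = (\<Sum>i<?n. \<Sum>j<?n. if lam i = x then ?w i j else 0)"
    by (intro sum.cong) auto
  \<comment> \<open>A nonzero weight forces \<open>lam i = mu j\<close>, so the two conditions may
    be exchanged.\<close>
  also have "\<dots> = (\<Sum>i<?n. \<Sum>j<?n. if mu j = x then ?w i j else 0)"
    using herm_decomp_overlap[OF U V] by (intro sum.cong refl) force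
  also have "\<dots> = (\<Sum>j<?n. \<Sum>i<?n. if mu j = x then ?w i j else 0)"
    by (rule sum.swap)
  also have "\<dots> = (\<Sum>j<?n. if mu j = x then \<Sum>i<?n. ?w i j else 0)"
    by (intro sum.cong) auto
  also have "\<dots> = (\<Sum>j<?n. if mu j = x then 1 else 0)"
    using col by (intro sum.cong) auto
  finally show "count (image_mset lam (mset_set {..<?n})) x = count (image_mset mu (mset_set {..<?n})) x"
    unfolding cnt[symmetric] by simp
qed

lemma herm_decomp_permute:
  assumes "herm_decomp d H r lam U" "p permutes {..<r}"
  shows "herm_decomp d H r (\<lambda>i. lam (p i)) (\<lambda>i. U (p i))"
proof -
  have p: "p i < r \<longleftrightarrow> i < r" for i using permutes_in_image[OF assms(2), of i] by simp
  have inj: "p i = p j \<longleftrightarrow> i = j" for i j using permutes_inj[OF assms(2)] by (auto simp: inj_def)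
  have "(\<Sum>i<r. complex_of_real (lam i) * U i a * cnj (U i b))
      = (\<Sum>i<r. complex_of_real (lam (p i)) * U (p i) a * cnj (U (p i) b))" for a b
    using sum.reindex_bij_betw[OF permutes_imp_bij[OF assms(2)],
        of "\<lambda>i. complex_of_real (lam i) * U i a * cnj (U i b)"] by simp
  with assms(1) show ?thesis
    by (simp add: herm_decomp_altdef orthonormal_def p inj)
qed

lemma herm_decomp_cong:
  assumes "\<And>i. i < r \<Longrightarrow> lam i = mu i"
  shows "herm_decomp d H r lam U \<longleftrightarrow> herm_decomp d H r mu U"
proof -
  have "(\<Sum>i<r. complex_of_real (lam i) * U i a * cnj (U i b))
      = (\<Sum>i<r. complex_of_real (mu i) * U i a * cnj (U i b))" for a b
    using assms by (intro sum.cong) auto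
  then show ?thesis by (simp add: herm_decomp_altdef)
qed

lemma length_herm_eigs [simp]: "length (herm_eigs d H) = card (MI d)"
  by (simp add: herm_eigs_def Let_def)

lemma herm_eigs_antimono:
  assumes "i \<le> j" "j < card (MI d)"
  shows "herm_eigs d H ! j \<le> herm_eigs d H ! i"
proof -
  have "sorted (rev (herm_eigs d H))" by (simp add: herm_eigs_def Let_def)
  then show ?thesis using assms by (simp add: sorted_rev_nth_mono)
qed

text \<open>\<open>herm_eigs\<close> takes its values from a decomposition picked by choice;
  uniqueness of the multiset allows any other decomposition to be used in its place.\<close>

lemma mset_herm_eigs:
  assumes "herm_decomp d H (card (MI d)) lam U"
  shows "mset (herm_eigs d H) = image_mset lam (mset_set {..<card (MI d)})"
proof -
  define l where "l = (SOME lam. \<exists>U. herm_decomp d H (card (MI d)) lam U)"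
  have "\<exists>U. herm_decomp d H (card (MI d)) l U"
    unfolding l_def using someI[of "\<lambda>lam. \<exists>U. herm_decomp d H (card (MI d)) lam U" lam] assms by blast
  then obtain V where "herm_decomp d H (card (MI d)) l V" ..
  from herm_decomp_unique[OF this assms] show ?thesis
    by (simp add: herm_eigs_def Let_def l_def[symmetric] atLeast0LessThan)
qed

lemma herm_eigs_decomp:
  assumes "hermitian d H"
  obtains U where "herm_decomp d H (card (MI d)) (\<lambda>i. herm_eigs d H ! i) U"
proof -
  let ?n = "card (MI d)"
  obtain lam U where U: "herm_decomp d H ?n lam U"
    using herm_decomp_exists[OF assms] by blast
  have "mset (herm_eigs d H) = mset (map lam [0..<?n])"
    by (simp add: mset_herm_eigs[OF U] atLeast0LessThan)
  then obtain p where p: "p permutes {..<?n}" "permute_list p (map lam [0..<?n]) = herm_eigs d H"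
    by (rule mset_eq_permutation) auto
  have eq: "lam (p i) = herm_eigs d H ! i" if "i < ?n" for i
    using permutes_in_image[OF p(1), of i] that p
    by (simp flip: p(2) add: permute_list_nth)
  have "herm_decomp d H ?n (\<lambda>i. herm_eigs d H ! i) (\<lambda>i. U (p i))"
    using herm_decomp_permute[OF U p(1)]
      herm_decomp_cong[where lam = "\<lambda>i. lam (p i)" and mu = "\<lambda>i. herm_eigs d H ! i", OF eq] by blast
  then show thesis by (rule that)
qed

section \<open>Functions of Hermitian tensors and their norms\<close>

lemma tfun_decomp:
  assumes "hermitian d H"
  obtains lam U where "herm_decomp d H (card (MI d)) lam U"
    "herm_decomp d (tfun d f H) (card (MI d)) (\<lambda>i. if lam i = 0 then 0 else f (lam i)) U"
proof -
  let ?n = "card (MI d)"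
  obtain lam U where S: "(SOME (lam, U). herm_decomp d H ?n lam U) = (lam, U)"
    by (metis surj_pair)
  have "case (SOME (lam, U). herm_decomp d H ?n lam U) of (lam, U) \<Rightarrow> herm_decomp d H ?n lam U"
    by (rule someI_ex) (use herm_decomp_exists[OF assms] in auto)
  then have U: "herm_decomp d H ?n lam U" by (simp add: S)
  have "tfun d f H = (\<lambda>a b. \<Sum>i<?n. complex_of_real (if lam i = 0 then 0 else f (lam i))
                                  * U i a * cnj (U i b))"
    by (simp add: tfun_def S if_distrib cong: if_cong)
  with U show thesis
    by (intro that[of lam U]) (auto simp: herm_decomp_altdef)
qed

lemma einstein_square_decomp:
  assumes A: "herm_decomp d A r lam U"
  shows "herm_decomp d (einstein d (ctrans A) A) r (\<lambda>i. (lam i)\<^sup>2) U"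
proof -
  have "ctrans A = A" using herm_decomp_hermitian[OF A] by (simp add: hermitian_def)
  have "einstein d (ctrans A) A a b = (\<Sum>i<r. complex_of_real ((lam i)\<^sup>2) * U i a * cnj (U i b))" for a b
  proof -
    have col: "(\<lambda>k. A k b) = (\<lambda>k. \<Sum>i<r. (complex_of_real (lam i) * cnj (U i b)) * U i k)"
      using A by (simp add: herm_decomp_altdef algebra_simps)
    have "einstein d (ctrans A) A a b = tapply d A (\<lambda>k. A k b) a"
      by (simp add: \<open>ctrans A = A\<close> einstein_def tapply_def)
    also have "\<dots> = (\<Sum>i<r. complex_of_real (lam i) * tinner d (\<lambda>k. A k b) (U i) * U i a)"
      by (simp add: tapply_decomp[OF A])
    also have "\<dots> = (\<Sum>i<r. complex_of_real (lam i) * (complex_of_real (lam i) * cnj (U i b)) * U i a)"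
      unfolding col using tinner_lincomb_left[OF herm_decomp_orthonormal[OF A]]
      by (intro sum.cong) auto
    finally show ?thesis by (simp add: power2_eq_square algebra_simps)
  qed
  with A show ?thesis unfolding herm_decomp_altdef by blast
qed

lemma mset_herm_eigs_tabs:
  assumes A: "herm_decomp d A (card (MI d)) lam U"
  shows "mset (herm_eigs d (tabs d A)) = image_mset (\<lambda>i. \<bar>lam i\<bar>) (mset_set {..<card (MI d)})"
proof -
  let ?n = "card (MI d)"
  note sq = einstein_square_decomp[OF A]
  obtain mu V where V: "herm_decomp d (einstein d (ctrans A) A) ?n mu V"
      "herm_decomp d (tabs d A) ?n (\<lambda>i. if mu i = 0 then 0 else sqrt (mu i)) V"
    unfolding tabs_def using tfun_decomp[OF herm_decomp_hermitian[OF sq]] by blast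
  \<comment> \<open>Since \<open>sqrt 0 = 0\<close>, the convention for zero eigenvalues in
    \<open>tfun\<close> leaves the square root unchanged.\<close>
  have "mset (herm_eigs d (tabs d A)) = image_mset sqrt (image_mset mu (mset_set {..<?n}))"
    unfolding mset_herm_eigs[OF V(2)] image_mset.compositionality by (rule image_mset_cong) auto
  also have "\<dots> = image_mset (\<lambda>i. \<bar>lam i\<bar>) (mset_set {..<?n})"
    unfolding herm_decomp_unique[OF V(1) sq] image_mset.compositionality
    by (rule image_mset_cong) simp
  finally show ?thesis .
qed

lemma sym_gaugeD:
  assumes "sym_gauge n \<rho>" "length x = n"
  shows "0 \<le> \<rho> x"
    and "\<rho> x = 0 \<Longrightarrow> v \<in> set x \<Longrightarrow> v = 0"
    and "\<rho> (map (\<lambda>v. c * v) x) = \<bar>c\<bar> * \<rho> x"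
    and "length y = n \<Longrightarrow> \<rho> (map2 (+) x y) \<le> \<rho> x + \<rho> y"
    and "mset y = mset x \<Longrightarrow> \<rho> y = \<rho> x"
    and "length e = n \<Longrightarrow> \<forall>s\<in>set e. s = 1 \<or> s = -1 \<Longrightarrow> \<rho> (map2 (*) e x) = \<rho> x"
  using assms unfolding sym_gauge_def by blast+

text \<open>The decompositions chosen inside \<open>tfun\<close> and behind \<open>herm_eigs\<close>
  may differ, but a gauge is blind to order and sees only the multiset, on which they agree.\<close>

lemma ui_norm_tfun:
  assumes \<rho>: "sym_gauge (card (MI d)) \<rho>" and H: "hermitian d H"
  shows "ui_norm d \<rho> (tfun d f H)
       = \<rho> (map (\<lambda>i. if herm_eigs d H ! i = 0 then 0 else \<bar>f (herm_eigs d H ! i)\<bar>) [0..<card (MI d)])"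
proof -
  let ?n = "card (MI d)"
  let ?g = "\<lambda>x. if x = 0 then 0 else \<bar>f x\<bar>"
  obtain lam U where U: "herm_decomp d H ?n lam U"
      "herm_decomp d (tfun d f H) ?n (\<lambda>i. if lam i = 0 then 0 else f (lam i)) U"
    using tfun_decomp[OF H] by blast
  have "mset (herm_eigs d (tabs d (tfun d f H))) = image_mset ?g (image_mset lam (mset_set {..<?n}))"
    unfolding mset_herm_eigs_tabs[OF U(2)] image_mset.compositionality by (rule image_mset_cong) auto
  also have "\<dots> = mset (map ?g (herm_eigs d H))"
    by (simp add: mset_herm_eigs[OF U(1)])
  also have "map ?g (herm_eigs d H) = map (\<lambda>i. ?g (herm_eigs d H ! i)) [0..<?n]"
    by (rule nth_equalityI) auto
  finally have "\<rho> (herm_eigs d (tabs d (tfun d f H))) = \<rho> (map (\<lambda>i. ?g (herm_eigs d H ! i)) [0..<?n])"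
    by (intro sym_gaugeD(5)[OF \<rho>]) auto
  then show ?thesis by (simp add: ui_norm_def)
qed

section \<open>Hermitian rank as the number of positive eigenvalues\<close>

lemma tinner_tapply_decomp:
  assumes "herm_decomp d H r lam U"
  shows "tinner d (tapply d H v) v = of_real (\<Sum>i<r. lam i * (cmod (tinner d v (U i)))\<^sup>2)"
proof -
  have "tinner d (tapply d H v) v = (\<Sum>i<r. complex_of_real (lam i) * (tinner d v (U i) * cnj (tinner d v (U i))))"
    unfolding tapply_decomp[OF assms] tinner_sum_left tinner_scale_left tinner_cnj
    by (simp add: mult.assoc)
  then show ?thesis by (simp only: of_real_sum of_real_mult complex_norm_square)
qed

text \<open>Computed in the system \<open>V\<close>, the Rayleigh quotient of \<open>U j\<close> is
  \<open>lam j\<close> times the sum of its squared overlaps. As \<open>lam j\<close> is nonzero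
  that sum is 1, and adding up over j with Bessel for \<open>U\<close> on the other side compares m
  with r.\<close>

lemma nonzero_eigs_le_decomp_size:
  assumes U: "herm_decomp d H m lam U" and nz: "\<And>j. j < m \<Longrightarrow> lam j \<noteq> 0"
    and V: "herm_decomp d H r mu V"
  shows "m \<le> r"
proof -
  have one: "(\<Sum>i<r. (cmod (tinner d (U j) (V i)))\<^sup>2) = 1" if j: "j < m" for j
  proof -
    have "of_real (lam j) = tinner d (tapply d H (U j)) (U j)"
      unfolding tapply_eigenvector[OF U j] tinner_scale_left
      using orthonormalD(2)[OF herm_decomp_orthonormal[OF U] j j] by simp
    also have "\<dots> = of_real (\<Sum>i<r. mu i * (cmod (tinner d (U j) (V i)))\<^sup>2)"
      by (rule tinner_tapply_decomp[OF V])
    also have "(\<Sum>i<r. mu i * (cmod (tinner d (U j) (V i)))\<^sup>2) = (\<Sum>i<r. lam j * (cmod (tinner d (U j) (V i)))\<^sup>2)"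
      using herm_decomp_overlap[OF U V j] by (intro sum.cong refl) force
    also have "\<dots> = lam j * (\<Sum>i<r. (cmod (tinner d (U j) (V i)))\<^sup>2)"
      by (simp add: sum_distrib_left)
    finally show ?thesis using nz[OF j] unfolding of_real_eq_iff by simp
  qed
  have "real m = (\<Sum>j<m. \<Sum>i<r. (cmod (tinner d (U j) (V i)))\<^sup>2)" using one by simp
  also have "\<dots> = (\<Sum>i<r. \<Sum>j<m. (cmod (tinner d (V i) (U j)))\<^sup>2)"
    by (subst sum.swap) (simp add: cmod_tinner_commute)
  also have "\<dots> \<le> (\<Sum>i<r. Re (tinner d (V i) (V i)))"
    by (intro sum_mono bessel herm_decomp_orthonormal[OF U])
  also have "\<dots> = real r" using orthonormalD(2)[OF herm_decomp_orthonormal[OF V]] by simp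
  finally show ?thesis by simp
qed

lemma herm_decomp_truncate:
  assumes U: "herm_decomp d H n lam U" and "m \<le> n" and zero: "\<And>i. m \<le> i \<Longrightarrow> i < n \<Longrightarrow> lam i = 0"
  shows "herm_decomp d H m lam U"
proof -
  have "(\<Sum>i<n. complex_of_real (lam i) * U i a * cnj (U i b))
      = (\<Sum>i<m. complex_of_real (lam i) * U i a * cnj (U i b))" for a b
    using \<open>m \<le> n\<close> zero by (intro sum.mono_neutral_right) auto
  then show ?thesis using U \<open>m \<le> n\<close> by (simp add: herm_decomp_altdef orthonormal_def)
qed

text \<open>Decreasing order and nonnegativity make the nonzero eigenvalues an initial segment.
  Cutting the decomposition off after it bounds the least length from above; the preceding count
  bounds it from below.\<close>

lemma nonneg_herm_rank:
  assumes H: "nonneg_herm d H" and r: "hermitian_rank d H = r"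
  shows "r \<le> card (MI d)"
    and "\<And>i. i < r \<Longrightarrow> 0 < herm_eigs d H ! i"
    and "\<And>i. r \<le> i \<Longrightarrow> i < card (MI d) \<Longrightarrow> herm_eigs d H ! i = 0"
proof -
  let ?n = "card (MI d)" and ?e = "\<lambda>i. herm_eigs d H ! i"
  have herm: "hermitian d H" and nonneg: "\<And>i. i < ?n \<Longrightarrow> 0 \<le> ?e i"
    using H by (auto simp: nonneg_herm_def)
  obtain U where U: "herm_decomp d H ?n ?e U" by (rule herm_eigs_decomp[OF herm])
  define N where "N = {i. i < ?n \<and> ?e i \<noteq> 0}"
  define m where "m = card N"
  have down: "j \<in> N" if "i \<in> N" "j \<le> i" for i j
    using that herm_eigs_antimono[of j i d H] nonneg[of i] by (auto simp: N_def)
  have "finite N" by (simp add: N_def)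
  have N: "N = {..<m}"
  proof (cases "N = {}")
    case True then show ?thesis by (simp add: m_def)
  next
    case False
    then have "Max N \<in> N" using \<open>finite N\<close> by simp
    then have "N = {..Max N}" using down \<open>finite N\<close> by (auto intro: Max_ge)
    then have N: "N = {..<Suc (Max N)}" by (simp only: lessThan_Suc_atMost)
    have m: "m = Suc (Max N)" unfolding m_def by (subst N) simp
    show ?thesis unfolding m by (rule N)
  qed
  have mn: "m \<le> ?n" unfolding m_def using card_mono[of "{..<?n}" N] by (auto simp: N_def)
  have pos: "0 < ?e i" if "i < m" for i
  proof -
    have "i \<in> N" unfolding N using that by simp
    then show ?thesis using nonneg[of i] by (simp add: N_def less_le)
  qed
  have zero: "?e i = 0" if "m \<le> i" "i < ?n" for i
  proof -
    have "i \<notin> N" unfolding N using that by simp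
    then show ?thesis using that by (simp add: N_def)
  qed
  have Um: "herm_decomp d H m ?e U"
    by (rule herm_decomp_truncate[OF U mn zero])
  then have "r \<le> m"
    unfolding r[symmetric] hermitian_rank_def by (intro Least_le) blast
  have "\<exists>lam U. herm_decomp d H r lam U"
    unfolding r[symmetric] hermitian_rank_def by (rule LeastI) (use Um in blast)
  then obtain mu V where "herm_decomp d H r mu V" by blast
  from nonzero_eigs_le_decomp_size[OF Um _ this] pos have "m \<le> r" by force
  with \<open>r \<le> m\<close> have "m = r" by simp
  with mn pos zero show "r \<le> ?n" "\<And>i. i < r \<Longrightarrow> 0 < ?e i" "\<And>i. r \<le> i \<Longrightarrow> i < ?n \<Longrightarrow> ?e i = 0"
    by auto
qed

lemma ui_norm_tfun_rank:
  assumes \<rho>: "sym_gauge (card (MI d)) \<rho>" and H: "nonneg_herm d H" and r: "hermitian_rank d H = r"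
    and f: "\<And>x. 0 < x \<Longrightarrow> 0 \<le> f x"
  shows "ui_norm d \<rho> (tfun d f H)
       = \<rho> (map (\<lambda>i. if i < r then f (herm_eigs d H ! i) else 0) [0..<card (MI d)])"
proof -
  have "hermitian d H" using H by (simp add: nonneg_herm_def)
  have "(if herm_eigs d H ! i = 0 then 0 else \<bar>f (herm_eigs d H ! i)\<bar>)
      = (if i < r then f (herm_eigs d H ! i) else 0)" if "i < card (MI d)" for i
    using nonneg_herm_rank(2)[OF H r, of i] nonneg_herm_rank(3)[OF H r, of i] f[of "herm_eigs d H ! i"] that
    by (cases "i < r") auto
  then show ?thesis unfolding ui_norm_tfun[OF \<rho> \<open>hermitian d H\<close>] by (intro arg_cong[of _ _ \<rho>] map_cong) auto
qed

section \<open>Ky Fan's principle and continuity of the eigenvalues\<close>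

lemma weighted_sum_le_top_sum:
  fixes e w :: "nat \<Rightarrow> real"
  assumes anti: "\<And>i j. i \<le> j \<Longrightarrow> j < n \<Longrightarrow> e j \<le> e i"
    and w: "\<And>j. j < n \<Longrightarrow> 0 \<le> w j" "\<And>j. j < n \<Longrightarrow> w j \<le> 1" and sum_w: "(\<Sum>j<n. w j) = real k"
    and k: "k \<le> n"
  shows "(\<Sum>j<n. e j * w j) \<le> (\<Sum>j<k. e j)"
proof (cases "k = 0")
  case True
  then have "sum w {..<n} = 0" using sum_w by simp
  then have "\<forall>j\<in>{..<n}. w j = 0"
    using w(1) sum_nonneg_eq_0_iff[of "{..<n}" w] by simp
  then show ?thesis using True by simp
next
  case False
  \<comment> \<open>Threshold at the last of the top k values. Since the weights add up to k,
    subtracting it costs k c on both sides, and afterwards the sums can be compared term by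
    term.\<close>
  define c where "c = e (k - 1)"
  have "(\<Sum>j<n. (e j - c) * w j) \<le> (\<Sum>j<n. if j < k then e j - c else 0)"
  proof (rule sum_mono)
    fix j assume "j \<in> {..<n}"
    then have j: "j < n" by simp
    show "(e j - c) * w j \<le> (if j < k then e j - c else 0)"
    proof (cases "j < k")
      case True
      then have "0 \<le> e j - c" using anti[of j "k - 1"] False k by (simp add: c_def)
      with True w(2)[OF j] show ?thesis by (simp add: mult_left_le)
    next
      case jk: False
      then have "e j - c \<le> 0" using anti[of "k - 1" j] j by (simp add: c_def)
      with jk w(1)[OF j] show ?thesis by (simp add: mult_nonpos_nonneg)
    qed
  qed
  also have "\<dots> = (\<Sum>j<k. e j - c)"
    using k by (intro sum.mono_neutral_cong_right) auto
  finally show ?thesis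
    using sum_w by (simp add: left_diff_distrib sum_subtractf flip: sum_distrib_left)
qed

lemma orthonormal_entry_le:
  assumes "orthonormal d r U" "i < r" "a \<in> MI d"
  shows "cmod (U i a) \<le> 1"
proof -
  have "(cmod (U i a))\<^sup>2 \<le> (\<Sum>i<r. (cmod (U i a))\<^sup>2)"
    using assms(2) by (intro member_le_sum) auto
  also have "\<dots> \<le> 1" by (rule orthonormal_coord_le[OF assms(1,3)])
  finally show ?thesis by (simp add: abs_square_le_1)
qed

text \<open>Ky Fan's maximum principle, applied to the top eigenvectors of \<^term>\<open>H\<close>.\<close>

lemma top_eigs_sum_perturb:
  assumes H: "hermitian d H" and H': "hermitian d H'" and k: "k \<le> card (MI d)"
  shows "(\<Sum>i<k. herm_eigs d H ! i) \<le> (\<Sum>i<k. herm_eigs d H' ! i)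
           + real k * (\<Sum>a\<in>MI d. \<Sum>b\<in>MI d. cmod (H a b - H' a b))"
proof -
  let ?n = "card (MI d)"
  obtain U where U: "herm_decomp d H ?n (\<lambda>i. herm_eigs d H ! i) U" by (rule herm_eigs_decomp[OF H])
  obtain V where V: "herm_decomp d H' ?n (\<lambda>i. herm_eigs d H' ! i) V" by (rule herm_eigs_decomp[OF H'])
  note oU = herm_decomp_orthonormal[OF U] and oV = herm_decomp_orthonormal[OF V]
  have oUk: "orthonormal d k U" using oU k by (simp add: orthonormal_def)
  define \<Delta> where "\<Delta> = (\<Sum>a\<in>MI d. \<Sum>b\<in>MI d. cmod (H a b - H' a b))"
  have step: "herm_eigs d H ! i \<le> (\<Sum>j<?n. herm_eigs d H' ! j * (cmod (tinner d (U i) (V j)))\<^sup>2) + \<Delta>"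
    if i: "i < ?n" for i
  proof -
    have "tinner d (tapply d H (U i)) (U i) = of_real (herm_eigs d H ! i)"
      unfolding tapply_eigenvector[OF U i] tinner_scale_left
      using orthonormalD(2)[OF oU i i] by simp
    moreover have "Re (tinner d (tapply d H (U i)) (U i)) \<le> Re (tinner d (tapply d H' (U i)) (U i)) + \<Delta>"
    proof -
      have "tinner d (tapply d H (U i)) (U i) - tinner d (tapply d H' (U i)) (U i)
          = (\<Sum>a\<in>MI d. \<Sum>b\<in>MI d. (H a b - H' a b) * U i b * cnj (U i a))"
        by (simp add: tinner_def tapply_def sum_distrib_right sum_subtractf left_diff_distrib)
      also have "cmod \<dots> \<le> \<Delta>"
        unfolding \<Delta>_def
      proof (intro order_trans[OF norm_sum] sum_mono)
        fix a b assume ab: "a \<in> MI d" "b \<in> MI d"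
        have "cmod ((H a b - H' a b) * U i b * cnj (U i a)) = cmod (H a b - H' a b) * (cmod (U i b) * cmod (U i a))"
          by (simp add: norm_mult)
        also have "\<dots> \<le> cmod (H a b - H' a b) * 1"
          using orthonormal_entry_le[OF oU i] ab by (intro mult_left_mono mult_le_one) auto
        finally show "cmod ((H a b - H' a b) * U i b * cnj (U i a)) \<le> cmod (H a b - H' a b)" by simp
      qed
      finally show ?thesis
        using complex_Re_le_cmod[of "tinner d (tapply d H (U i)) (U i) - tinner d (tapply d H' (U i)) (U i)"]
        by simp
    qed
    ultimately show ?thesis unfolding tinner_tapply_decomp[OF V] by simp
  qed
  \<comment> \<open>The squared length of the projection of \<open>V j\<close> to the span of the
    top k eigenvectors of \<open>H\<close>: at most 1 by Bessel, and with total k by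
    Parseval.\<close>
  define w where "w j = (\<Sum>i<k. (cmod (tinner d (U i) (V j)))\<^sup>2)" for j
  have "(\<Sum>i<k. herm_eigs d H ! i)
      \<le> (\<Sum>i<k. (\<Sum>j<?n. herm_eigs d H' ! j * (cmod (tinner d (U i) (V j)))\<^sup>2) + \<Delta>)"
    using step k by (intro sum_mono) auto
  also have "\<dots> = (\<Sum>j<?n. herm_eigs d H' ! j * w j) + real k * \<Delta>"
    unfolding sum.distrib w_def sum_distrib_left by (subst sum.swap) simp
  also have "(\<Sum>j<?n. herm_eigs d H' ! j * w j) \<le> (\<Sum>j<k. herm_eigs d H' ! j)"
  proof (rule weighted_sum_le_top_sum[OF herm_eigs_antimono _ _ _ k])
    show "0 \<le> w j" for j by (simp add: w_def sum_nonneg)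
    show "w j \<le> 1" if "j < ?n" for j
      using bessel[OF oUk, of "V j"] orthonormalD(2)[OF oV that that]
      by (simp add: w_def cmod_tinner_commute)
    have "(\<Sum>j<?n. w j) = (\<Sum>i<k. Re (tinner d (U i) (U i)))"
      unfolding w_def by (subst sum.swap) (simp add: parseval[OF oV])
    also have "\<dots> = real k" using orthonormalD(2)[OF oUk] by simp
    finally show "(\<Sum>j<?n. w j) = real k" .
  qed
  finally show ?thesis by (simp add: \<Delta>_def)
qed

lemma continuous_on_top_eigs_sum:
  fixes D :: "'a::t2_space \<Rightarrow> tensor"
  assumes herm: "\<And>t. hermitian d (D t)" and cont: "\<And>i j. continuous_on UNIV (\<lambda>t. D t i j)"
    and k: "k \<le> card (MI d)"
  shows "continuous_on UNIV (\<lambda>t. \<Sum>i<k. herm_eigs d (D t) ! i)"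
  unfolding continuous_on_eq_continuous_at[OF open_UNIV]
proof
  fix s
  let ?S = "\<lambda>t. \<Sum>i<k. herm_eigs d (D t) ! i"
  let ?g = "\<lambda>t. real k * (\<Sum>a\<in>MI d. \<Sum>b\<in>MI d. cmod (D t a b - D s a b))"
  have "continuous_on UNIV ?g" by (intro continuous_intros cont)
  then have "isCont ?g s" using continuous_on_eq_continuous_at[OF open_UNIV] by blast
  then have "(?g \<longlongrightarrow> ?g s) (at s)" by (simp only: isCont_def)
  then have lim: "(?g \<longlongrightarrow> 0) (at s)" by simp
  have "norm (?S t - ?S s) \<le> ?g t" for t
    using top_eigs_sum_perturb[OF herm herm k, of t s] top_eigs_sum_perturb[OF herm herm k, of s t]
    by (simp add: norm_minus_commute abs_le_iff)
  then have "((\<lambda>t. ?S t - ?S s) \<longlongrightarrow> 0) (at s)"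
    by (intro Lim_null_comparison[OF _ lim] always_eventually allI)
  then show "isCont ?S s" unfolding isCont_def by (rule LIM_zero_cancel)
qed

text \<open>Ky Fan's principle controls sums of top eigenvalues, and a single eigenvalue is the
  difference of two consecutive ones. This is the source of all measurability below.\<close>

lemma continuous_on_herm_eigs:
  fixes D :: "'a::t2_space \<Rightarrow> tensor"
  assumes "\<And>t. hermitian d (D t)" "\<And>i j. continuous_on UNIV (\<lambda>t. D t i j)" "i < card (MI d)"
  shows "continuous_on UNIV (\<lambda>t. herm_eigs d (D t) ! i)"
proof -
  have "continuous_on UNIV (\<lambda>t. (\<Sum>j<Suc i. herm_eigs d (D t) ! j) - (\<Sum>j<i. herm_eigs d (D t) ! j))"
    using assms by (intro continuous_on_diff continuous_on_top_eigs_sum) auto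
  then show ?thesis by simp
qed

lemma tvnorm_tinner: "tvnorm d v = sqrt (Re (tinner d v v))"
  by (simp add: tvnorm_def tinner_self)

text \<open>A unit eigenvector competes in the supremum. Boundedness comes first, for the real
  \<open>Sup\<close> says nothing about unbounded sets; absolute row sums provide it.\<close>

lemma herm_eigs_le_op_norm:
  assumes H: "hermitian d H" and i: "i < card (MI d)"
  shows "herm_eigs d H ! i \<le> op_norm d H"
proof -
  obtain U where U: "herm_decomp d H (card (MI d)) (\<lambda>i. herm_eigs d H ! i) U"
    by (rule herm_eigs_decomp[OF H])
  note oU = herm_decomp_orthonormal[OF U]
  let ?S = "{tvnorm d (\<lambda>i. \<Sum>k\<in>MI d. H i k * x k) | x. (\<forall>i. i \<notin> MI d \<longrightarrow> x i = 0) \<and> tvnorm d x \<le> 1}"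
  have entry: "cmod (x k) \<le> 1" if "tvnorm d x \<le> 1" "k \<in> MI d" for x k
  proof -
    have "(cmod (x k))\<^sup>2 \<le> (\<Sum>a\<in>MI d. (cmod (x a))\<^sup>2)"
      using that(2) by (intro member_le_sum) auto
    also have "\<dots> \<le> 1" using that(1) by (simp add: tvnorm_def)
    finally show ?thesis by (simp add: abs_square_le_1)
  qed
  have "bdd_above ?S"
  proof (rule bdd_aboveI[of _ "sqrt (\<Sum>i\<in>MI d. (\<Sum>k\<in>MI d. cmod (H i k))\<^sup>2)"], clarify)
    fix x assume x: "tvnorm d x \<le> 1"
    have "cmod (\<Sum>k\<in>MI d. H i k * x k) \<le> (\<Sum>k\<in>MI d. cmod (H i k))" for i
      using entry[OF x]
      by (intro order_trans[OF norm_sum] sum_mono) (auto simp: norm_mult mult_left_le)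
    then show "tvnorm d (\<lambda>i. \<Sum>k\<in>MI d. H i k * x k) \<le> sqrt (\<Sum>i\<in>MI d. (\<Sum>k\<in>MI d. cmod (H i k))\<^sup>2)"
      unfolding tvnorm_def by (intro real_sqrt_le_mono sum_mono power_mono) auto
  qed
  moreover have "tvnorm d (tapply d H (U i)) \<in> ?S"
    using orthonormalD[OF oU i] i by (auto simp: tapply_def tvnorm_tinner)
  ultimately have "tvnorm d (tapply d H (U i)) \<le> op_norm d H"
    unfolding op_norm_def by (intro cSup_upper)
  moreover have "tvnorm d (tapply d H (U i)) = \<bar>herm_eigs d H ! i\<bar>"
    unfolding tvnorm_tinner tapply_eigenvector[OF U i] tinner_scale_left tinner_scale_right
    using orthonormalD(2)[OF oU i i] by (simp flip: power2_eq_square)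
  ultimately show ?thesis by linarith
qed

section \<open>Symmetric gauge functions and majorization\<close>

lemma sym_gauge_nonneg:
  "sym_gauge n \<rho> \<Longrightarrow> 0 \<le> \<rho> (map a [0..<n])"
  by (rule sym_gaugeD(1)) auto

lemma sym_gauge_pos:
  assumes "sym_gauge n \<rho>" "i < n" "a i \<noteq> 0"
  shows "0 < \<rho> (map a [0..<n])"
proof -
  have "\<rho> (map a [0..<n]) \<noteq> 0"
  proof
    assume "\<rho> (map a [0..<n]) = 0"
    then have "a i = 0"
      by (rule sym_gaugeD(2)[OF assms(1), rotated]) (use assms(2) in auto)
    with assms(3) show False by simp
  qed
  with sym_gauge_nonneg[OF assms(1), of a] show ?thesis by simp
qed

lemma sym_gauge_scale:
  assumes "sym_gauge n \<rho>"
  shows "\<rho> (map (\<lambda>i. c * a i) [0..<n]) = \<bar>c\<bar> * \<rho> (map a [0..<n])"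
proof -
  have "\<rho> (map (\<lambda>v. c * v) (map a [0..<n])) = \<bar>c\<bar> * \<rho> (map a [0..<n])"
    by (rule sym_gaugeD(3)[OF assms]) simp
  then show ?thesis by (simp add: o_def)
qed

lemma sym_gauge_triangle:
  assumes "sym_gauge n \<rho>"
  shows "\<rho> (map (\<lambda>i. a i + b i) [0..<n]) \<le> \<rho> (map a [0..<n]) + \<rho> (map b [0..<n])"
proof -
  have "\<rho> (map2 (+) (map a [0..<n]) (map b [0..<n])) \<le> \<rho> (map a [0..<n]) + \<rho> (map b [0..<n])"
    by (rule sym_gaugeD(4)[OF assms]) auto
  then show ?thesis by (simp add: map2_map_map)
qed

lemma sym_gauge_permute:
  assumes "sym_gauge n \<rho>" "p permutes {..<n}"
  shows "\<rho> (map (\<lambda>i. a (p i)) [0..<n]) = \<rho> (map a [0..<n])"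
proof -
  have "mset (map (\<lambda>i. a (p i)) [0..<n]) = image_mset a (image_mset p (mset_set {..<n}))"
    by (simp add: image_mset.compositionality atLeast0LessThan o_def)
  also have "\<dots> = mset (map a [0..<n])"
    by (simp add: permutes_image_mset[OF assms(2)] atLeast0LessThan)
  finally show ?thesis
    by (intro sym_gaugeD(5)[OF assms(1)]) auto
qed

lemma sym_gauge_flip:
  assumes "sym_gauge n \<rho>"
  shows "\<rho> (map (\<lambda>i. (if i = j then -1 else 1) * a i) [0..<n]) = \<rho> (map a [0..<n])"
proof -
  let ?e = "map (\<lambda>i. if i = j then -1 else 1 :: real) [0..<n]"
  have "\<forall>s\<in>set ?e. s = 1 \<or> s = -1" by auto
  then have "\<rho> (map2 (*) ?e (map a [0..<n])) = \<rho> (map a [0..<n])"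
    by (intro sym_gaugeD(6)[OF assms]) auto
  then show ?thesis by (simp add: map2_map_map)
qed

text \<open>Shrinking one coordinate is a convex combination of the identity and a sign flip.\<close>

lemma sym_gauge_shrink_coord:
  assumes \<rho>: "sym_gauge n \<rho>" and t: "0 \<le> t" "t \<le> 1"
  shows "\<rho> (map (\<lambda>i. (if i = j then t else 1) * a i) [0..<n]) \<le> \<rho> (map a [0..<n])"
proof -
  have eq: "(\<lambda>i. (if i = j then t else 1) * a i)
      = (\<lambda>i. (1 + t) / 2 * a i + (1 - t) / 2 * ((if i = j then -1 else 1) * a i))"
    by (auto simp: fun_eq_iff field_simps)
  have "\<rho> (map (\<lambda>i. (if i = j then t else 1) * a i) [0..<n])
      \<le> \<rho> (map (\<lambda>i. (1 + t) / 2 * a i) [0..<n])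
        + \<rho> (map (\<lambda>i. (1 - t) / 2 * ((if i = j then -1 else 1) * a i)) [0..<n])"
    unfolding eq by (rule sym_gauge_triangle[OF \<rho>])
  also have "\<dots> = (1 + t) / 2 * \<rho> (map a [0..<n]) + (1 - t) / 2 * \<rho> (map a [0..<n])"
    unfolding sym_gauge_scale[OF \<rho>] sym_gauge_flip[OF \<rho>] using t by simp
  also have "\<dots> = \<rho> (map a [0..<n])" by (simp add: field_simps)
  finally show ?thesis .
qed

text \<open>The coordinates of b are shrunk to those of a one at a time. Where b vanishes so does a,
  and the factor 0 will do.\<close>

lemma sym_gauge_mono:
  assumes \<rho>: "sym_gauge n \<rho>" and ab: "\<And>i. i < n \<Longrightarrow> 0 \<le> a i" "\<And>i. i < n \<Longrightarrow> a i \<le> b i"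
  shows "\<rho> (map a [0..<n]) \<le> \<rho> (map b [0..<n])"
proof -
  have "\<rho> (map (\<lambda>i. if i < m then a i else b i) [0..<n]) \<le> \<rho> (map b [0..<n])" if "m \<le> n" for m
    using that
  proof (induction m)
    case 0
    show ?case by simp
  next
    case (Suc m)
    define t where "t = (if b m = 0 then 0 else a m / b m)"
    have t: "0 \<le> t" "t \<le> 1" "a m = t * b m"
      using ab[of m] Suc.prems by (auto simp: t_def divide_le_eq)
    have eq: "(\<lambda>i. if i < Suc m then a i else b i)
        = (\<lambda>i. (if i = m then t else 1) * (if i < m then a i else b i))"
      using t(3) by (auto simp: fun_eq_iff less_Suc_eq)
    have "\<rho> (map (\<lambda>i. if i < Suc m then a i else b i) [0..<n])
        \<le> \<rho> (map (\<lambda>i. if i < m then a i else b i) [0..<n])"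
      unfolding eq by (rule sym_gauge_shrink_coord[OF \<rho> t(1,2)])
    also have "\<dots> \<le> \<rho> (map b [0..<n])" using Suc by simp
    finally show ?case .
  qed
  moreover have "map (\<lambda>i. if i < n then a i else b i) [0..<n] = map a [0..<n]" by simp
  ultimately show ?thesis by (metis order_refl)
qed

lemma sym_gauge_convex:
  assumes \<rho>: "sym_gauge n \<rho>" and t: "0 \<le> t" "0 \<le> s"
    and a: "\<And>i. i < n \<Longrightarrow> 0 \<le> a i" "\<And>i. i < n \<Longrightarrow> a i \<le> t * b i + s * c i"
  shows "\<rho> (map a [0..<n]) \<le> t * \<rho> (map b [0..<n]) + s * \<rho> (map c [0..<n])"
proof -
  have "\<rho> (map a [0..<n]) \<le> \<rho> (map (\<lambda>i. t * b i + s * c i) [0..<n])"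
    by (rule sym_gauge_mono[OF \<rho> a])
  also have "\<dots> \<le> \<rho> (map (\<lambda>i. t * b i) [0..<n]) + \<rho> (map (\<lambda>i. s * c i) [0..<n])"
    by (rule sym_gauge_triangle[OF \<rho>])
  also have "\<dots> = t * \<rho> (map b [0..<n]) + s * \<rho> (map c [0..<n])"
    using t by (simp add: sym_gauge_scale[OF \<rho>])
  finally show ?thesis .
qed

section \<open>Ky Fan norms, the gauges of the converse direction\<close>

definition ky_fan :: "nat \<Rightarrow> real list \<Rightarrow> real" where
  "ky_fan k x = Max ((\<lambda>S. \<Sum>i\<in>S. \<bar>x ! i\<bar>) ` {S. S \<subseteq> {..<length x} \<and> card S = k})"

lemma finite_card_subsets: "finite {S. S \<subseteq> {..<n::nat} \<and> card S = k}"
  by (rule finite_subset[of _ "Pow {..<n}"]) auto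

lemma ky_fan_ge:
  "S \<subseteq> {..<length x} \<Longrightarrow> card S = k \<Longrightarrow> (\<Sum>i\<in>S. \<bar>x ! i\<bar>) \<le> ky_fan k x"
  unfolding ky_fan_def by (intro Max_ge finite_imageI finite_card_subsets) auto

lemma ky_fan_attained:
  assumes "k \<le> length x"
  obtains S where "S \<subseteq> {..<length x}" "card S = k" "ky_fan k x = (\<Sum>i\<in>S. \<bar>x ! i\<bar>)"
proof -
  have "{..<k} \<in> {S. S \<subseteq> {..<length x} \<and> card S = k}" using assms by auto
  then have "ky_fan k x \<in> (\<lambda>S. \<Sum>i\<in>S. \<bar>x ! i\<bar>) ` {S. S \<subseteq> {..<length x} \<and> card S = k}"
    unfolding ky_fan_def by (intro Max_in finite_imageI finite_card_subsets) blast
  with that show thesis by blast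
qed

lemma ky_fan_le:
  assumes "k \<le> length x" "\<And>S. S \<subseteq> {..<length x} \<Longrightarrow> card S = k \<Longrightarrow> (\<Sum>i\<in>S. \<bar>x ! i\<bar>) \<le> B"
  shows "ky_fan k x \<le> B"
  using ky_fan_attained[OF assms(1)] assms(2) by metis

lemma ky_fan_mset_le:
  assumes "k \<le> length x" "mset y = mset x"
  shows "ky_fan k y \<le> ky_fan k x"
proof -
  have len: "length y = length x" using assms(2) by (rule mset_eq_length)
  obtain p where p: "p permutes {..<length x}" "permute_list p x = y"
    using mset_eq_permutation[OF assms(2)] by blast
  show ?thesis
  proof (rule ky_fan_le)
    show "k \<le> length y" using assms(1) len by simp
    fix S assume S: "S \<subseteq> {..<length y}" "card S = k"
    have inj: "inj_on p S" using permutes_inj[OF p(1)] by (auto simp: inj_def inj_on_def)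
    have "(\<Sum>i\<in>S. \<bar>y ! i\<bar>) = (\<Sum>i\<in>S. \<bar>x ! (p i)\<bar>)"
      using S len p by (intro sum.cong) (auto simp: permute_list_nth)
    also have "\<dots> = (\<Sum>i\<in>p ` S. \<bar>x ! i\<bar>)" by (simp add: sum.reindex[OF inj])
    also have "\<dots> \<le> ky_fan k x"
    proof (rule ky_fan_ge)
      show "p ` S \<subseteq> {..<length x}" using S(1) len permutes_image[OF p(1)] by auto
      show "card (p ` S) = k" using S(2) by (simp add: card_image[OF inj])
    qed
    finally show "(\<Sum>i\<in>S. \<bar>y ! i\<bar>) \<le> ky_fan k x" .
  qed
qed

text \<open>As \<open>ky_fan\<close> is a maximum over index sets, each axiom can be checked on one
  fixed set, without sorting. Positivity of k gives definiteness: every index then lies in some set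
  of size k.\<close>

lemma sym_gauge_ky_fan:
  assumes k: "0 < k" "k \<le> n"
  shows "sym_gauge n (ky_fan k)"
  unfolding sym_gauge_def
proof (intro conjI allI impI)
  fix x :: "real list" assume x: "length x = n"
  obtain S where S: "S \<subseteq> {..<length x}" "card S = k" "ky_fan k x = (\<Sum>i\<in>S. \<bar>x ! i\<bar>)"
    using ky_fan_attained[of k x] x k by auto
  show "0 \<le> ky_fan k x" unfolding S(3) by (intro sum_nonneg) simp
  show "\<forall>v\<in>set x. v = 0" if "ky_fan k x = 0"
  proof
    fix v assume "v \<in> set x"
    then obtain i where i: "i < n" "v = x ! i" using x by (auto simp: in_set_conv_nth)
    obtain T where T: "{i} \<subseteq> T" "T \<subseteq> {..<n}" "card T = k"
      using exists_subset_between[of "{i}" k "{..<n}"] i k by auto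
    have "finite T" using T(2) finite_subset by blast
    then have "\<bar>x ! i\<bar> \<le> (\<Sum>i\<in>T. \<bar>x ! i\<bar>)" using T(1) by (intro member_le_sum) auto
    also have "\<dots> \<le> 0" using ky_fan_ge[of T x k] T x that by simp
    finally show "v = 0" using i by simp
  qed
  show "ky_fan k (map ((*) c) x) = \<bar>c\<bar> * ky_fan k x" for c
  proof (rule antisym)
    show "ky_fan k (map ((*) c) x) \<le> \<bar>c\<bar> * ky_fan k x"
    proof (rule ky_fan_le)
      fix S assume S: "S \<subseteq> {..<length (map ((*) c) x)}" "card S = k"
      have "(\<Sum>i\<in>S. \<bar>map ((*) c) x ! i\<bar>) = (\<Sum>i\<in>S. \<bar>c\<bar> * \<bar>x ! i\<bar>)"
        using S by (intro sum.cong) (auto simp: abs_mult)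
      also have "\<dots> = \<bar>c\<bar> * (\<Sum>i\<in>S. \<bar>x ! i\<bar>)" by (simp add: sum_distrib_left)
      also have "\<dots> \<le> \<bar>c\<bar> * ky_fan k x"
        using S by (intro mult_left_mono ky_fan_ge) auto
      finally show "(\<Sum>i\<in>S. \<bar>map ((*) c) x ! i\<bar>) \<le> \<bar>c\<bar> * ky_fan k x" .
    qed (use x k in simp)
    have "\<bar>c\<bar> * ky_fan k x = (\<Sum>i\<in>S. \<bar>map ((*) c) x ! i\<bar>)"
      unfolding S(3) sum_distrib_left using S(1) by (intro sum.cong) (auto simp: abs_mult)
    also have "\<dots> \<le> ky_fan k (map ((*) c) x)" using S by (intro ky_fan_ge) auto
    finally show "\<bar>c\<bar> * ky_fan k x \<le> ky_fan k (map ((*) c) x)" .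
  qed
  show "ky_fan k (map2 (+) x y) \<le> ky_fan k x + ky_fan k y" if y: "length y = n" for y
  proof (rule ky_fan_le)
    fix S assume S: "S \<subseteq> {..<length (map2 (+) x y)}" "card S = k"
    have "(\<Sum>i\<in>S. \<bar>map2 (+) x y ! i\<bar>) \<le> (\<Sum>i\<in>S. \<bar>x ! i\<bar> + \<bar>y ! i\<bar>)"
      using S x y by (intro sum_mono) auto
    also have "\<dots> = (\<Sum>i\<in>S. \<bar>x ! i\<bar>) + (\<Sum>i\<in>S. \<bar>y ! i\<bar>)" by (rule sum.distrib)
    also have "\<dots> \<le> ky_fan k x + ky_fan k y"
      using S x y by (intro add_mono ky_fan_ge) auto
    finally show "(\<Sum>i\<in>S. \<bar>map2 (+) x y ! i\<bar>) \<le> ky_fan k x + ky_fan k y" .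
  qed (use x y k in simp)
  show "ky_fan k y = ky_fan k x" if "mset y = mset x" for y
    using ky_fan_mset_le[of k x y] ky_fan_mset_le[of k y x] that x k mset_eq_length[OF that] by simp
  show "ky_fan k (map2 (*) e x) = ky_fan k x"
    if e: "length e = n" "\<forall>s\<in>set e. s = 1 \<or> s = -1" for e
  proof -
    have "\<bar>map2 (*) e x ! i\<bar> = \<bar>x ! i\<bar>" if "i < n" for i
    proof -
      have "e ! i = 1 \<or> e ! i = -1" using e that by (simp add: nth_mem)
      then show ?thesis using e(1) x that by (auto simp: abs_mult)
    qed
    then have "(\<Sum>i\<in>S. \<bar>map2 (*) e x ! i\<bar>) = (\<Sum>i\<in>S. \<bar>x ! i\<bar>)" if "S \<subseteq> {..<n}" for S
      using that by (intro sum.cong) auto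
    then show ?thesis
      unfolding ky_fan_def using e(1) x by (intro arg_cong[of _ _ Max] image_cong) auto
  qed
qed

text \<open>The premise \<open>top\<close> takes the place of monotonicity because negative powers
  of a decreasing sequence increase and are then padded by zeros; for the full positive part the
  prefix is still the largest sum.\<close>

lemma ky_fan_eq_prefix_sum:
  assumes k: "k \<le> n" and a: "\<And>i. i < n \<Longrightarrow> 0 \<le> a i"
    and top: "\<And>S. S \<subseteq> {..<n} \<Longrightarrow> card S = k \<Longrightarrow> (\<Sum>i\<in>S. a i) \<le> (\<Sum>i<k. a i)"
  shows "ky_fan k (map a [0..<n]) = (\<Sum>i<k. a i)"
proof -
  have eq: "(\<Sum>i\<in>S. \<bar>map a [0..<n] ! i\<bar>) = (\<Sum>i\<in>S. a i)" if "S \<subseteq> {..<n}" for S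
    using that a by (intro sum.cong) auto
  show ?thesis
  proof (rule antisym)
    show "ky_fan k (map a [0..<n]) \<le> (\<Sum>i<k. a i)"
      by (rule ky_fan_le) (use k eq top in auto)
    show "(\<Sum>i<k. a i) \<le> ky_fan k (map a [0..<n])"
      using ky_fan_ge[of "{..<k}" "map a [0..<n]" k] k eq[of "{..<k}"] by simp
  qed
qed

lemma subset_sum_le_top_sum:
  fixes e :: "nat \<Rightarrow> real"
  assumes "\<And>i j. i \<le> j \<Longrightarrow> j < n \<Longrightarrow> e j \<le> e i" and S: "S \<subseteq> {..<n}" "card S = k"
  shows "(\<Sum>i\<in>S. e i) \<le> (\<Sum>i<k. e i)"
proof -
  have ind: "(\<Sum>j<n. g j * indicat_real S j) = (\<Sum>i\<in>S. g i)" for g :: "nat \<Rightarrow> real"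
    using S(1) by (intro sum.mono_neutral_cong_right) (auto simp: indicator_def)
  have "k \<le> n" using card_mono[OF finite_lessThan S(1)] S(2) by simp
  moreover have "(\<Sum>j<n. indicat_real S j) = real k" using ind[of "\<lambda>_. 1"] S(2) by simp
  ultimately have "(\<Sum>j<n. e j * indicat_real S j) \<le> (\<Sum>j<k. e j)"
    using assms(1) by (intro weighted_sum_le_top_sum) (auto simp: indicator_def)
  then show ?thesis unfolding ind .
qed

section \<open>Subgradients and majorization\<close>

definition coord_convex :: "((nat \<Rightarrow> real) \<Rightarrow> real) \<Rightarrow> bool" where
  "coord_convex F \<longleftrightarrow>
     (\<forall>x y t. 0 < t \<longrightarrow> t < 1 \<longrightarrow> F (\<lambda>i. t * x i + (1 - t) * y i) \<le> t * F x + (1 - t) * F y)"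

text \<open>The Hahn-Banach argument: a subgradient in the first \<^term>\<open>n\<close> directions is extended to the
  next one.\<close>

lemma subgradient_exists:
  assumes F: "coord_convex F"
  shows "\<exists>s. \<forall>y. (\<forall>i\<ge>n. y i = x i) \<longrightarrow> F x + (\<Sum>i<n. s i * (y i - x i)) \<le> F y"
proof (induction n)
  case 0
  have "y = x" if "\<forall>i\<ge>0. y i = x i" for y using that by (simp add: fun_eq_iff)
  then show ?case by auto
next
  case (Suc n)
  then obtain s where s: "\<And>y. (\<And>i. i \<ge> n \<Longrightarrow> y i = x i) \<Longrightarrow> F x + (\<Sum>i<n. s i * (y i - x i)) \<le> F y"
    by blast
  define adm where "adm y \<longleftrightarrow> (\<forall>i>n. y i = x i)" for y
  \<comment> \<open>G is the gap between F and the minorant known so far, and q the slope needed in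
    direction n to bridge it. A new slope fits if it separates the slopes to the left of
    \<open>x n\<close> from those to the right.\<close>
  define G where "G y = F y - F x - (\<Sum>i<n. s i * (y i - x i))" for y
  define q where "q y = G y / (y n - x n)" for y
  have le: "q y \<le> q z" if y: "adm y" "y n < x n" and z: "adm z" "x n < z n" for y z
  proof -
    define u v where "u = x n - y n" and "v = z n - x n"
    have uv: "u > 0" "v > 0" "y n - x n = - u" using y z by (auto simp: u_def v_def)
    \<comment> \<open>Weights for which the mixture of z and y has n-th coordinate
      \<open>x n\<close>, where the induction hypothesis applies.\<close>
    define t where "t = u / (u + v)"
    have t: "0 < t" "t < 1" "1 - t = v / (u + v)" using uv by (auto simp: t_def field_simps)
    define m where "m = (\<lambda>i. t * z i + (1 - t) * y i)"
    have "m n = x n"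
    proof -
      have "m n = t * (x n + v) + (1 - t) * (x n - u)" by (simp add: m_def u_def v_def)
      also have "\<dots> = x n + (t * v - (1 - t) * u)" by (simp add: algebra_simps)
      also have "t * v - (1 - t) * u = 0" unfolding t(3) by (simp add: t_def)
      finally show ?thesis by simp
    qed
    moreover have "m i = x i" if "i > n" for i
      using that y(1) z(1) by (simp add: m_def adm_def algebra_simps)
    ultimately have "F x + (\<Sum>i<n. s i * (m i - x i)) \<le> F m"
      by (intro s) (metis le_neq_implies_less)
    also have "F m \<le> t * F z + (1 - t) * F y"
      using F t unfolding coord_convex_def m_def by blast
    also have "(\<Sum>i<n. s i * (m i - x i))
        = t * (\<Sum>i<n. s i * (z i - x i)) + (1 - t) * (\<Sum>i<n. s i * (y i - x i))"
      unfolding sum_distrib_left sum.distrib[symmetric]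
      by (intro sum.cong) (auto simp: m_def algebra_simps)
    finally have "0 \<le> t * G z + (1 - t) * G y" by (simp add: G_def algebra_simps)
    also have "\<dots> = (u * G z + v * G y) / (u + v)"
      unfolding t(3) by (simp add: t_def add_divide_distrib)
    finally have "0 \<le> u * G z + v * G y" using uv by (simp add: zero_le_divide_iff)
    then have "- G y / u \<le> G z / v" using uv by (simp add: field_simps)
    moreover have "q y = - G y / u" "q z = G z / v"
      using uv(3) by (simp_all add: q_def v_def)
    ultimately show ?thesis by simp
  qed
  define Q where "Q = q ` {y. adm y \<and> y n < x n}"
  \<comment> \<open>The largest slope required on the left, which \<open>le\<close> keeps below
    every slope allowed on the right.\<close>
  define m where "m = Sup Q"
  have "q (x(n := x n - 1)) \<in> Q" unfolding Q_def by (intro imageI) (auto simp: adm_def)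
  then have "Q \<noteq> {}" by blast
  have bdd: "bdd_above Q"
    by (rule bdd_aboveI[of _ "q (x(n := x n + 1))"]) (auto simp: Q_def adm_def intro!: le)
  have lower: "q y \<le> m" if "adm y" "y n < x n" for y
    unfolding m_def by (rule cSup_upper[OF _ bdd]) (use that in \<open>auto simp: Q_def\<close>)
  have upper: "m \<le> q z" if "adm z" "x n < z n" for z
    unfolding m_def by (rule cSup_least[OF \<open>Q \<noteq> {}\<close>]) (use that le in \<open>auto simp: Q_def\<close>)
  show ?case
  proof (intro exI[of _ "s(n := m)"] allI impI)
    fix y assume y: "\<forall>i\<ge>Suc n. y i = x i"
    then have adm: "adm y" by (auto simp: adm_def)
    have "m * (y n - x n) \<le> G y"
    proof (rule linorder_cases[of "y n" "x n"])
      assume "y n < x n"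
      with lower[OF adm this] show ?thesis by (simp add: q_def divide_le_eq)
    next
      assume "x n < y n"
      with upper[OF adm this] show ?thesis by (simp add: q_def le_divide_eq)
    next
      assume eq: "y n = x n"
      then have "y i = x i" if "i \<ge> n" for i using that y by (cases "i = n") auto
      from s[of y, OF this] eq show ?thesis by (simp add: G_def)
    qed
    then show "F x + (\<Sum>i<Suc n. (s(n := m)) i * (y i - x i)) \<le> F y"
      by (simp add: G_def)
  qed
qed

text \<open>Summation by parts: the decreasing weights let each partial sum be discounted by the
  next weight. The weights may have any sign, so the boundary term at r is harmless only because the
  total is 0.\<close>

lemma abel_sum_nonneg:
  fixes w a :: "nat \<Rightarrow> real"
  assumes anti: "\<And>i j. i \<le> j \<Longrightarrow> j < r \<Longrightarrow> w j \<le> w i"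
    and P: "\<And>k. k \<le> r \<Longrightarrow> 0 \<le> (\<Sum>j<k. a j)" and P_r: "(\<Sum>j<r. a j) = 0"
  shows "0 \<le> (\<Sum>j<r. w j * a j)"
proof -
  have "w (m - 1) * (\<Sum>j<m. a j) \<le> (\<Sum>j<m. w j * a j)" if "m \<le> r" for m
    using that
  proof (induction m)
    case 0
    show ?case by simp
  next
    case (Suc m)
    have "w m * (\<Sum>j<m. a j) \<le> w (m - 1) * (\<Sum>j<m. a j)"
      using anti[of "m - 1" m] P[of m] Suc.prems by (intro mult_right_mono) auto
    also have "\<dots> \<le> (\<Sum>j<m. w j * a j)" using Suc by simp
    finally show ?case by (simp add: algebra_simps)
  qed
  from this[of r] P_r show ?thesis by simp
qed

lemma sorting_permutation:
  fixes s :: "nat \<Rightarrow> real"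
  obtains p where "p permutes {..<r}" "\<And>i j. i \<le> j \<Longrightarrow> j < r \<Longrightarrow> s (p j) \<le> s (p i)"
proof -
  let ?xs = "rev (sort (map s [0..<r]))"
  have "mset ?xs = mset (map s [0..<r])" by simp
  then obtain p where p: "p permutes {..<r}" "permute_list p (map s [0..<r]) = ?xs"
    by (rule mset_eq_permutation) auto
  have nth: "s (p i) = ?xs ! i" if "i < r" for i
    using permutes_in_image[OF p(1), of i] that p(1)
    by (simp flip: p(2) add: permute_list_nth)
  have "sorted (rev ?xs)" by simp
  then have "?xs ! j \<le> ?xs ! i" if "i \<le> j" "j < r" for i j
    using that by (intro sorted_rev_nth_mono) auto
  with p nth show thesis by (intro that[of p]) auto
qed

text \<open>Permuting the coordinates so that the subgradient at \<^term>\<open>x\<close> becomes decreasing, Abel summation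
  turns majorization of \<^term>\<open>x\<close> by \<^term>\<open>L\<close> into a supporting functional that may be anchored at
  \<^term>\<open>L\<close>.\<close>

lemma majorization_support:
  assumes F: "coord_convex F"
    and sym: "\<And>p y. p permutes {..<r} \<Longrightarrow> F (\<lambda>i. y (p i)) = F y"
    and dep: "\<And>y z. (\<And>i. i < r \<Longrightarrow> y i = z i) \<Longrightarrow> F y = F z"
    and x: "\<And>i j. i \<le> j \<Longrightarrow> j < r \<Longrightarrow> x j \<le> x i"
    and maj: "\<And>k. k \<le> r \<Longrightarrow> (\<Sum>i<k. x i) \<le> (\<Sum>i<k. L i)" and maj_r: "(\<Sum>i<r. x i) = (\<Sum>i<r. L i)"
  shows "\<exists>w. \<forall>y. F x + (\<Sum>i<r. w i * (y i - L i)) \<le> F y"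
proof -
  obtain s where s: "\<And>y. (\<And>i. i \<ge> r \<Longrightarrow> y i = x i) \<Longrightarrow> F x + (\<Sum>i<r. s i * (y i - x i)) \<le> F y"
    using subgradient_exists[OF F, of r x] by blast
  obtain p where p: "p permutes {..<r}" and anti: "\<And>i j. i \<le> j \<Longrightarrow> j < r \<Longrightarrow> s (p j) \<le> s (p i)"
    using sorting_permutation[of r s] by blast
  have perm_sum: "(\<Sum>j<r. g (p j)) = (\<Sum>j<r. g j)" for g :: "nat \<Rightarrow> real"
    by (rule sum.reindex_bij_betw[OF permutes_imp_bij[OF p]])
  have "F x + (\<Sum>j<r. s (p j) * (y j - L j)) \<le> F y" for y
  proof -
    \<comment> \<open>The subgradient inequality is available only for points that agree with x
      beyond r, so y is rearranged below r and replaced by x above.\<close>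
    let ?y = "\<lambda>i. if i < r then y (inv p i) else x i"
    have "F x + (\<Sum>i<r. s i * (?y i - x i)) \<le> F ?y" by (rule s) simp
    also have "F ?y = F (\<lambda>i. y (inv p i))" by (rule dep) simp
    also have "\<dots> = F y" by (rule sym[OF permutes_inv[OF p]])
    also have "(\<Sum>i<r. s i * (?y i - x i)) = (\<Sum>j<r. s (p j) * (y j - x (p j)))"
      unfolding perm_sum[of "\<lambda>i. s i * (?y i - x i)", symmetric]
      using permutes_in_image[OF p] permutes_inverses(2)[OF p] by (intro sum.cong) auto
    finally have 1: "F x + (\<Sum>j<r. s (p j) * (y j - x (p j))) \<le> F y" .
    \<comment> \<open>Moving the anchor from the rearranged x to L raises the functional: a prefix
      of the rearranged x sums to at most the prefix of x, hence to at most that of L.\<close>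
    have "0 \<le> (\<Sum>j<r. s (p j) * (L j - x (p j)))"
    proof (rule abel_sum_nonneg[OF anti])
      show "0 \<le> (\<Sum>j<k. L j - x (p j))" if "k \<le> r" for k
      proof -
        have inj: "inj_on p {..<k}" using permutes_inj[OF p] by (auto simp: inj_def inj_on_def)
        have "(\<Sum>j<k. x (p j)) = (\<Sum>i\<in>p ` {..<k}. x i)" by (simp add: sum.reindex[OF inj])
        also have "\<dots> \<le> (\<Sum>j<k. x j)"
        proof (rule subset_sum_le_top_sum[OF x])
          show "p ` {..<k} \<subseteq> {..<r}" using that permutes_image[OF p] by auto
          show "card (p ` {..<k}) = k" by (simp add: card_image[OF inj])
        qed
        also have "\<dots> \<le> (\<Sum>j<k. L j)" by (rule maj[OF that])
        finally show ?thesis by (simp add: sum_subtractf)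
      qed
      show "(\<Sum>j<r. L j - x (p j)) = 0" using maj_r by (simp add: sum_subtractf perm_sum)
    qed
    with 1 show ?thesis by (simp add: right_diff_distrib sum_subtractf)
  qed
  then show ?thesis by (intro exI[of _ "\<lambda>j. s (p j)"] allI)
qed

section \<open>Logarithmic means\<close>

text \<open>The norm of f applied to a tensor, read off its spectrum. The padding by zeros is what
  \<open>tfun\<close> makes of zero eigenvalues, whatever f does near 0.\<close>

definition gauge_fun :: "(real list \<Rightarrow> real) \<Rightarrow> nat \<Rightarrow> nat \<Rightarrow> (real \<Rightarrow> real) \<Rightarrow> (nat \<Rightarrow> real) \<Rightarrow> real" where
  "gauge_fun \<rho> n r f a = \<rho> (map (\<lambda>i. if i < r then f (a i) else 0) [0..<n])"

lemma gauge_fun_cong: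
  assumes "\<And>i. i < r \<Longrightarrow> f (a i) = g (b i)"
  shows "gauge_fun \<rho> n r f a = gauge_fun \<rho> n r g b"
  unfolding gauge_fun_def using assms by (intro arg_cong[of _ _ \<rho>] map_cong) auto

lemma gauge_fun_permute:
  assumes \<rho>: "sym_gauge n \<rho>" and "r \<le> n" and p: "p permutes {..<r}"
  shows "gauge_fun \<rho> n r f (\<lambda>i. a (p i)) = gauge_fun \<rho> n r f a"
proof -
  have "p permutes {..<n}" using \<open>r \<le> n\<close> by (intro permutes_subset[OF p]) auto
  from sym_gauge_permute[OF \<rho> this, of "\<lambda>i. if i < r then f (a i) else 0"]
  show ?thesis using permutes_in_image[OF p] by (simp add: gauge_fun_def)
qed

lemma gauge_fun_nonneg: "sym_gauge n \<rho> \<Longrightarrow> 0 \<le> gauge_fun \<rho> n r f a"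
  unfolding gauge_fun_def by (rule sym_gauge_nonneg)

lemma gauge_fun_pos:
  assumes "sym_gauge n \<rho>" "0 < r" "r \<le> n" "0 < f (a 0)"
  shows "0 < gauge_fun \<rho> n r f a"
  unfolding gauge_fun_def using assms by (intro sym_gauge_pos[of n \<rho> 0]) auto

lemma gauge_fun_zero:
  assumes "sym_gauge n \<rho>" "\<And>i. i < r \<Longrightarrow> f (a i) = 0"
  shows "gauge_fun \<rho> n r f a = 0"
proof -
  have "gauge_fun \<rho> n r f a = \<rho> (map (\<lambda>i. 0 * 0) [0..<n])"
    unfolding gauge_fun_def using assms(2) by (intro arg_cong[of _ _ \<rho>] map_cong) auto
  then show ?thesis using sym_gauge_scale[OF assms(1), of 0 "\<lambda>_. 0"] by simp
qed

lemma coord_convex_gauge_fun: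
  assumes \<rho>: "sym_gauge n \<rho>" and h: "\<And>x. 0 \<le> h x" "convex_on UNIV h"
  shows "coord_convex (gauge_fun \<rho> n r h)"
  unfolding coord_convex_def
proof (intro allI impI)
  fix x y :: "nat \<Rightarrow> real" and t :: real
  assume t: "0 < t" "t < 1"
  show "gauge_fun \<rho> n r h (\<lambda>i. t * x i + (1 - t) * y i) \<le> t * gauge_fun \<rho> n r h x + (1 - t) * gauge_fun \<rho> n r h y"
    unfolding gauge_fun_def
    using t h(1) convex_onD[OF h(2), of "1 - t"] by (intro sym_gauge_convex[OF \<rho>]) auto
qed

lemma exp_convex_combination:
  fixes t :: real
  assumes "0 \<le> t" "t \<le> 1"
  shows "exp (t * a + (1 - t) * b) \<le> t * exp a + (1 - t) * exp b"
  using convex_onD[OF exp_convex, of "1 - t" a b] assms by simp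

text \<open>Hoelder's inequality for \<^term>\<open>\<rho>\<close>: AM-GM applied to vectors normalised to gauge 1.\<close>

lemma coord_convex_ln_gauge_fun:
  assumes \<rho>: "sym_gauge n \<rho>" and r: "0 < r" "r \<le> n" and h: "convex_on UNIV h"
  shows "coord_convex (\<lambda>x. ln (gauge_fun \<rho> n r (\<lambda>u. exp (h u)) x))"
  unfolding coord_convex_def
proof (intro allI impI)
  fix x y :: "nat \<Rightarrow> real" and t :: real
  assume t: "0 < t" "t < 1"
  let ?G = "gauge_fun \<rho> n r (\<lambda>u. exp (h u))"
  have pos: "0 < ?G z" for z by (rule gauge_fun_pos[OF \<rho> r]) simp
  let ?m = "\<lambda>i. t * x i + (1 - t) * y i"
  \<comment> \<open>The factors \<open>exp (- \<alpha>)\<close> and \<open>exp (- \<beta>)\<close>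
    bring the vectors of x and y to gauge 1; their convex combination has gauge at most 1, and
    \<open>exp \<gamma>\<close> is the factor left over.\<close>
  define \<alpha> \<beta> where "\<alpha> = ln (?G x)" and "\<beta> = ln (?G y)"
  define \<gamma> where "\<gamma> = t * \<alpha> + (1 - t) * \<beta>"
  have "?G ?m \<le> exp \<gamma> * t * exp (- \<alpha>) * ?G x + exp \<gamma> * (1 - t) * exp (- \<beta>) * ?G y"
    unfolding gauge_fun_def
  proof (rule sym_gauge_convex[OF \<rho>])
    fix i assume "i < n"
    have "h (?m i) \<le> t * h (x i) + (1 - t) * h (y i)"
      using convex_onD[OF h, of "1 - t" "x i" "y i"] t by simp
    then have "exp (h (?m i)) \<le> exp (\<gamma> + (t * (h (x i) - \<alpha>) + (1 - t) * (h (y i) - \<beta>)))"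
      by (simp add: \<gamma>_def algebra_simps)
    also have "\<dots> \<le> exp \<gamma> * (t * exp (h (x i) - \<alpha>) + (1 - t) * exp (h (y i) - \<beta>))"
      unfolding exp_add[of \<gamma>] using t by (intro mult_left_mono exp_convex_combination) auto
    also have "\<dots> = exp \<gamma> * t * exp (- \<alpha>) * exp (h (x i)) + exp \<gamma> * (1 - t) * exp (- \<beta>) * exp (h (y i))"
      by (simp add: exp_diff exp_minus field_simps)
    finally show "(if i < r then exp (h (?m i)) else 0)
        \<le> exp \<gamma> * t * exp (- \<alpha>) * (if i < r then exp (h (x i)) else 0)
          + exp \<gamma> * (1 - t) * exp (- \<beta>) * (if i < r then exp (h (y i)) else 0)" by simp
  qed (use t in auto)
  also have "\<dots> = exp \<gamma>"
    using pos[of x] pos[of y] by (simp add: \<alpha>_def \<beta>_def exp_minus algebra_simps)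
  finally have "ln (?G ?m) \<le> ln (exp \<gamma>)" using pos[of ?m] by (subst ln_le_cancel_iff) auto
  then show "ln (?G ?m) \<le> t * ln (?G x) + (1 - t) * ln (?G y)"
    by (simp add: \<gamma>_def \<alpha>_def \<beta>_def)
qed

section \<open>Extended integrals and logarithms\<close>

lemma ext_int_mono:
  assumes "\<And>x. \<phi> x \<le> \<psi> x"
  shows "ext_int M \<phi> \<le> ext_int M \<psi>"
  unfolding ext_int_def
  by (intro ereal_minus_mono)
     (simp_all add: less_eq_ennreal.rep_eq[symmetric] nn_integral_mono e2ennreal_mono assms)

lemma ext_int_ereal:
  assumes "integrable M a"
  shows "ext_int M (\<lambda>x. ereal (a x)) = ereal (integral\<^sup>L M a)"
proof -
  have fin: "(\<integral>\<^sup>+x. ennreal (a x) \<partial>M) < \<top>" "(\<integral>\<^sup>+x. ennreal (- a x) \<partial>M) < \<top>"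
    using integrableD(2)[OF assms] integrableD(3)[OF assms] by (auto simp: less_top)
  have conv: "enn2ereal u = ereal (enn2real u)" if "u < \<top>" for u
    using that by (cases u) (auto simp: enn2ereal_ennreal)
  show ?thesis
    unfolding ext_int_def by (simp add: real_lebesgue_integral_def[OF assms] conv[OF fin(1)] conv[OF fin(2)])
qed

lemma eexp_mono: "x \<le> y \<Longrightarrow> eexp x \<le> eexp y"
  by (cases x; cases y) (auto simp: eexp_def)

lemma eexp_nonneg: "0 \<le> eexp x"
  by (cases x) (auto simp: eexp_def)

lemma eexp_ereal [simp]: "eexp (ereal x) = ereal (exp x)"
  by (simp add: eexp_def)

lemma elog_pos: "0 < x \<Longrightarrow> elog x = ereal (ln x)"
  by (simp add: elog_def)

text \<open>A convex function on the line with values below infinity that is minus infinity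
  somewhere is so everywhere. Only strictly positive f are then left for the logarithmic
  argument.\<close>

lemma log_exp_convex_zero:
  assumes f: "\<And>x. 0 < x \<Longrightarrow> 0 \<le> f x" "log_exp_convex f" and x: "0 < x" "f x = 0" and y: "0 < y"
  shows "f y = 0"
proof -
  \<comment> \<open>The reflection of \<open>ln x\<close> in \<open>ln y\<close>, which makes
    \<open>ln y\<close> the midpoint.\<close>
  define z where "z = 2 * ln y - ln x"
  have "elog (f (exp (1/2 * ln x + (1 - 1/2) * z)))
      \<le> ereal (1/2) * elog (f (exp (ln x))) + ereal (1 - 1/2) * elog (f (exp z))"
    using f(2)[unfolded log_exp_convex_def, rule_format, of "1/2" "ln x" z] by simp
  moreover have "1/2 * ln x + (1 - 1/2) * z = ln y" by (simp add: z_def field_simps)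
  moreover have "ereal (1/2) * elog (f (exp (ln x))) = -\<infinity>"
    using x by (simp add: elog_def)
  moreover have "ereal (1 - 1/2) * elog (f (exp z)) \<noteq> \<infinity>"
    by (simp add: elog_def)
  ultimately have "elog (f y) = -\<infinity>"
    using y by (cases "ereal (1 - 1/2) * elog (f (exp z))") auto
  then show ?thesis using f(1)[OF y] by (auto simp: elog_def split: if_splits)
qed

lemma convex_on_ln_of_log_exp_convex:
  assumes f: "\<And>x. 0 < x \<Longrightarrow> 0 < f x" "log_exp_convex f"
  shows "convex_on UNIV (\<lambda>u. ln (f (exp u)))"
proof (rule convex_onI)
  fix t x y :: real assume t: "0 < t" "t < 1"
  have "elog (f (exp ((1 - t) * x + (1 - (1 - t)) * y)))
      \<le> ereal (1 - t) * elog (f (exp x)) + ereal (1 - (1 - t)) * elog (f (exp y))"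
    using f(2)[unfolded log_exp_convex_def, rule_format, of "1 - t" x y] t by simp
  then show "ln (f (exp ((1 - t) *\<^sub>R x + t *\<^sub>R y))) \<le> (1 - t) * ln (f (exp x)) + t * ln (f (exp y))"
    using f(1) by (simp add: elog_pos)
qed simp

section \<open>From powers to logarithms\<close>

lemma powr_le_affine:
  fixes x p :: real
  assumes "0 < x" "0 < p" "p \<le> 1"
  shows "x powr p \<le> 1 + p * (x - 1)"
  using exp_convex_combination[of p "ln x" 0] assms by (simp add: powr_def algebra_simps)

lemma ln_le_powr_quotient:
  fixes x p :: real
  assumes "0 < x" "0 < p"
  shows "ln x \<le> (x powr p - 1) / p"
  using ln_le_minus_one[of "x powr p"] assms by (simp add: ln_powr field_simps)

text \<open>With the preceding bound, the quotients are trapped between \<open>ln x\<close> and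
  \<open>x - 1\<close> uniformly in p. This is the domination for p tending to 0.\<close>

lemma powr_quotient_le:
  fixes x p :: real
  assumes "0 < x" "0 < p" "p \<le> 1"
  shows "(x powr p - 1) / p \<le> x - 1"
  using powr_le_affine[OF assms] assms by (simp add: field_simps)

lemma powr_quotient_tendsto:
  fixes x :: real
  assumes "0 < x"
  shows "(\<lambda>m. (x powr inverse (real (Suc m)) - 1) / inverse (real (Suc m))) \<longlonglongrightarrow> ln x"
proof -
  have "((\<lambda>p. x powr p) has_real_derivative ln x) (at 0)"
    using assms by (auto intro!: derivative_eq_intros simp: powr_def)
  then have "((\<lambda>p. (x powr p - 1) / p) \<longlongrightarrow> ln x) (at 0)"
    using assms by (simp add: has_field_derivative_iff)
  moreover have "filterlim (\<lambda>m. inverse (real (Suc m))) (at 0) sequentially"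
    using LIMSEQ_inverse_real_of_nat by (auto simp: filterlim_at)
  ultimately show ?thesis by (rule filterlim_compose)
qed

context prob_space
begin

lemma powr_sums_imp_ln_sums:
  fixes C :: "nat \<Rightarrow> real" and E :: "'a \<Rightarrow> nat \<Rightarrow> real"
  assumes C: "\<And>i. i < k \<Longrightarrow> 0 < C i" and E: "\<And>i t. i < k \<Longrightarrow> 0 < E t i"
    and int: "\<And>i. i < k \<Longrightarrow> integrable M (\<lambda>t. E t i)" "\<And>i. i < k \<Longrightarrow> integrable M (\<lambda>t. ln (E t i))"
    and int_p: "\<And>i p. i < k \<Longrightarrow> 0 < p \<Longrightarrow> p \<le> 1 \<Longrightarrow> integrable M (\<lambda>t. E t i powr p)"
    and le: "\<And>p. 0 < p \<Longrightarrow> p \<le> 1 \<Longrightarrow> (\<Sum>i<k. C i powr p) \<le> (\<integral>t. (\<Sum>i<k. E t i powr p) \<partial>M)"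
  shows "(\<Sum>i<k. ln (C i)) \<le> (\<Sum>i<k. \<integral>t. ln (E t i) \<partial>M)"
proof -
  define p where "p m = inverse (real (Suc m))" for m
  have p: "0 < p m" "p m \<le> 1" for m by (auto simp: p_def field_simps)
  have "(\<lambda>m. \<integral>t. (E t i powr p m - 1) / p m \<partial>M) \<longlonglongrightarrow> (\<integral>t. ln (E t i) \<partial>M)" if i: "i < k" for i
  proof (rule integral_dominated_convergence[where w = "\<lambda>t. \<bar>ln (E t i)\<bar> + \<bar>E t i - 1\<bar>"])
    show "(\<lambda>t. ln (E t i)) \<in> borel_measurable M" using int(2)[OF i] by simp
    show "(\<lambda>t. (E t i powr p m - 1) / p m) \<in> borel_measurable M" for m
      using int_p[OF i p] by simp
    show "integrable M (\<lambda>t. \<bar>ln (E t i)\<bar> + \<bar>E t i - 1\<bar>)"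
      using int(1)[OF i] int(2)[OF i] by (intro Bochner_Integration.integrable_add integrable_abs) auto
    show "AE t in M. (\<lambda>m. (E t i powr p m - 1) / p m) \<longlonglongrightarrow> ln (E t i)"
      unfolding p_def using powr_quotient_tendsto[OF E[OF i]] by simp
    show "AE t in M. norm ((E t i powr p m - 1) / p m) \<le> \<bar>ln (E t i)\<bar> + \<bar>E t i - 1\<bar>" for m
    proof (rule AE_I2)
      fix t
      show "norm ((E t i powr p m - 1) / p m) \<le> \<bar>ln (E t i)\<bar> + \<bar>E t i - 1\<bar>"
        using ln_le_powr_quotient[OF E[OF i] p(1), of t m] powr_quotient_le[OF E[OF i] p, of t m]
        unfolding real_norm_def by linarith
    qed
  qed
  then have "(\<lambda>m. \<Sum>i<k. \<integral>t. (E t i powr p m - 1) / p m \<partial>M) \<longlonglongrightarrow> (\<Sum>i<k. \<integral>t. ln (E t i) \<partial>M)"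
    by (intro tendsto_sum) auto
  moreover have "(\<Sum>i<k. ln (C i)) \<le> (\<Sum>i<k. \<integral>t. (E t i powr p m - 1) / p m \<partial>M)" for m
  proof -
    \<comment> \<open>On this side the bound holds for each p, so only the integrals pass to the
      limit. Total mass 1 lets the constant -1 be moved under them.\<close>
    have "(\<Sum>i<k. ln (C i)) \<le> (\<Sum>i<k. (C i powr p m - 1) / p m)"
      using C p by (intro sum_mono ln_le_powr_quotient) auto
    also have "\<dots> = ((\<Sum>i<k. C i powr p m) - real k) / p m"
      by (simp add: sum_subtractf flip: sum_divide_distrib)
    also have "\<dots> \<le> ((\<integral>t. (\<Sum>i<k. E t i powr p m) \<partial>M) - real k) / p m"
      using le[OF p] p(1)[of m] by (intro divide_right_mono) auto
    also have "(\<integral>t. (\<Sum>i<k. E t i powr p m) \<partial>M) = (\<Sum>i<k. \<integral>t. E t i powr p m \<partial>M)"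
      using int_p p by (intro Bochner_Integration.integral_sum) auto
    also have "((\<Sum>i<k. \<integral>t. E t i powr p m \<partial>M) - real k) / p m
        = (\<Sum>i<k. ((\<integral>t. E t i powr p m \<partial>M) - 1) / p m)"
      by (simp add: sum_subtractf flip: sum_divide_distrib)
    also have "\<dots> = (\<Sum>i<k. \<integral>t. (E t i powr p m - 1) / p m \<partial>M)"
      using int_p p by (intro sum.cong refl) (simp add: prob_space)
    finally show ?thesis .
  qed
  ultimately show ?thesis by (intro LIMSEQ_le_const) auto
qed

text \<open>Jensen's inequality for the logarithm, from its tangent at the mean m. The tangent
  exists because a strictly positive function on a probability space has positive integral.\<close>

lemma le_integral_of_le_exp_ext_int:
  assumes S: "\<And>t. 0 < S t" "integrable M S" "integrable M (\<lambda>t. ln (S t))"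
    and A: "ereal A \<le> eexp (ext_int M (\<lambda>t. elog (S t)))"
  shows "A \<le> (\<integral>t. S t \<partial>M)"
proof -
  define m where "m = (\<integral>t. S t \<partial>M)"
  have "0 \<le> m" unfolding m_def using S(1) by (intro integral_nonneg_AE AE_I2 less_imp_le)
  moreover have "m \<noteq> 0"
  proof
    assume "m = 0"
    then have "AE t in M. S t = 0"
      unfolding m_def using S(1,2) by (subst (asm) integral_nonneg_eq_0_iff_AE) (auto intro: less_imp_le)
    then have "AE t in M. False" using S(1) by (auto elim!: eventually_mono simp: less_le)
    then show False by simp
  qed
  ultimately have m: "0 < m" by simp
  have "(\<integral>t. ln (S t) \<partial>M) \<le> (\<integral>t. ln m + (S t / m - 1) \<partial>M)"
  proof (rule integral_mono[OF S(3)])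
    show "integrable M (\<lambda>t. ln m + (S t / m - 1))" using S(2) by simp
    show "ln (S t) \<le> ln m + (S t / m - 1)" for t
      using ln_le_minus_one[of "S t / m"] S(1)[of t] m by (simp add: ln_div)
  qed
  also have "\<dots> = ln m" using S(2) m by (simp add: prob_space m_def[symmetric])
  finally have "exp (\<integral>t. ln (S t) \<partial>M) \<le> m" using m by (simp add: ln_ge_iff)
  moreover have "ereal A \<le> ereal (exp (\<integral>t. ln (S t) \<partial>M))"
    using A S(1) by (simp add: elog_pos ext_int_ereal[OF S(3)])
  ultimately show ?thesis by (simp add: m_def)
qed

end

section \<open>The equivalences for positive decreasing sequences\<close>

locale positive_spectra = prob_space +
  fixes n r :: nat and c :: "nat \<Rightarrow> real" and e :: "'a \<Rightarrow> nat \<Rightarrow> real"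
  assumes r_le: "r \<le> n"
    and c_pos: "i < r \<Longrightarrow> 0 < c i"
    and c_antimono: "i \<le> j \<Longrightarrow> j < r \<Longrightarrow> c j \<le> c i"
    and e_pos: "i < r \<Longrightarrow> 0 < e t i"
    and e_antimono: "i \<le> j \<Longrightarrow> j < r \<Longrightarrow> e t j \<le> e t i"
    and integrable_e: "i < r \<Longrightarrow> integrable M (\<lambda>t. e t i)"
    and integrable_inverse_e: "i < r \<Longrightarrow> integrable M (\<lambda>t. inverse (e t i))"
begin

lemma measurable_e [measurable]: "i < r \<Longrightarrow> (\<lambda>t. e t i) \<in> borel_measurable M"
  using integrable_e by blast

definition mean_log :: "nat \<Rightarrow> real" where
  "mean_log i = (\<integral>t. ln (e t i) \<partial>M)"

definition log_majorized :: bool where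
  "log_majorized \<longleftrightarrow> (\<forall>k\<le>r. (\<Sum>i<k. ln (c i)) \<le> (\<Sum>i<k. mean_log i))
      \<and> (\<Sum>i<r. ln (c i)) = (\<Sum>i<r. mean_log i)"

definition log_mean_bound :: bool where
  "log_mean_bound \<longleftrightarrow> (\<forall>f \<rho>. continuous_on {0<..} f \<and> (\<forall>x>0. 0 \<le> f x) \<and> log_exp_convex f \<and> sym_gauge n \<rho>
     \<longrightarrow> ereal (gauge_fun \<rho> n r f c) \<le> eexp (ext_int M (\<lambda>t. elog (gauge_fun \<rho> n r f (e t)))))"

definition mean_bound :: bool where
  "mean_bound \<longleftrightarrow> (\<forall>g \<rho>. continuous_on {0<..} g \<and> (\<forall>x>0. 0 \<le> g x) \<and> convex_on UNIV (\<lambda>x. g (exp x)) \<and> sym_gauge n \<rho>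
     \<longrightarrow> ennreal (gauge_fun \<rho> n r g c) \<le> (\<integral>\<^sup>+t. ennreal (gauge_fun \<rho> n r g (e t)) \<partial>M))"

text \<open>For an exponent p in (0, 1] the power is at most \<open>1 + x\<close>; this is applied
  to the eigenvalue if q is positive and to its inverse if q is negative.\<close>

lemma integrable_powr_e:
  assumes i: "i < r" and q: "q \<noteq> 0" "\<bar>q\<bar> \<le> 1"
  shows "integrable M (\<lambda>t. e t i powr q)"
proof (rule Bochner_Integration.integrable_bound)
  show "integrable M (\<lambda>t. 1 + e t i + inverse (e t i))"
    using integrable_e[OF i] integrable_inverse_e[OF i] by simp
  show "(\<lambda>t. e t i powr q) \<in> borel_measurable M" using i by measurable
  show "AE t in M. norm (e t i powr q) \<le> norm (1 + e t i + inverse (e t i))"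
  proof (rule AE_I2)
    fix t
    note pos = e_pos[OF i, of t]
    have bound: "x powr p \<le> 1 + x" if "0 < x" "0 < p" "p \<le> 1" for x p :: real
    proof -
      have "p * (x - 1) \<le> x"
      proof (cases "1 \<le> x")
        case True
        then have "p * (x - 1) \<le> 1 * (x - 1)" using that by (intro mult_right_mono) auto
        then show ?thesis by simp
      next
        case False
        then have "p * (x - 1) \<le> 0" using that by (intro mult_nonneg_nonpos) auto
        then show ?thesis using that by simp
      qed
      with powr_le_affine[OF that] show ?thesis by simp
    qed
    have "e t i powr q \<le> 1 + e t i + inverse (e t i)"
    proof (cases "0 < q")
      case True
      then show ?thesis using bound[OF pos, of q] q pos by (simp add: add_increasing2)
    next
      case False
      have "inverse (e t i) powr (- q) = e t i powr q" using pos
        by (simp add: powr_minus inverse_powr)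
      then show ?thesis using bound[of "inverse (e t i)" "- q"] False q pos by simp
    qed
    then show "norm (e t i powr q) \<le> norm (1 + e t i + inverse (e t i))" using pos by simp
  qed
qed

lemma integrable_ln_e:
  assumes i: "i < r"
  shows "integrable M (\<lambda>t. ln (e t i))"
proof (rule Bochner_Integration.integrable_bound)
  show "integrable M (\<lambda>t. e t i + inverse (e t i))"
    using integrable_e[OF i] integrable_inverse_e[OF i] by simp
  show "(\<lambda>t. ln (e t i)) \<in> borel_measurable M" using i by measurable
  show "AE t in M. norm (ln (e t i)) \<le> norm (e t i + inverse (e t i))"
  proof (rule AE_I2)
    fix t
    note pos = e_pos[OF i, of t]
    have "0 < inverse (e t i)" using pos by simp
    then show "norm (ln (e t i)) \<le> norm (e t i + inverse (e t i))"
      using ln_le_minus_one[OF pos] ln_le_minus_one[of "inverse (e t i)"] pos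
      unfolding real_norm_def ln_inverse by linarith
  qed
qed

text \<open>The weights are the same for all t, so the minorant is integrable along with the log
  eigenvalues. Being anchored at their means, its linear part integrates to 0.\<close>

lemma log_majorized_minorant:
  assumes maj: log_majorized and F: "coord_convex F"
    and sym: "\<And>p y. p permutes {..<r} \<Longrightarrow> F (\<lambda>i. y (p i)) = F y"
    and dep: "\<And>y z. (\<And>i. i < r \<Longrightarrow> y i = z i) \<Longrightarrow> F y = F z"
  shows "\<exists>a. integrable M a \<and> (\<forall>t. a t \<le> F (\<lambda>i. ln (e t i))) \<and> (\<integral>t. a t \<partial>M) = F (\<lambda>i. ln (c i))"
proof -
  have anti: "ln (c j) \<le> ln (c i)" if "i \<le> j" "j < r" for i j
    using c_antimono[OF that] c_pos[of j] that by simp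
  have "\<exists>w. \<forall>y. F (\<lambda>i. ln (c i)) + (\<Sum>i<r. w i * (y i - mean_log i)) \<le> F y"
  proof (rule majorization_support[OF F sym dep anti])
    show "(\<Sum>i<k. ln (c i)) \<le> (\<Sum>i<k. mean_log i)" if "k \<le> r" for k
      using maj that by (simp add: log_majorized_def)
    show "(\<Sum>i<r. ln (c i)) = (\<Sum>i<r. mean_log i)"
      using maj by (simp add: log_majorized_def)
  qed
  then obtain w where w: "\<And>y. F (\<lambda>i. ln (c i)) + (\<Sum>i<r. w i * (y i - mean_log i)) \<le> F y"
    by blast
  let ?a = "\<lambda>t. F (\<lambda>i. ln (c i)) + (\<Sum>i<r. w i * (ln (e t i) - mean_log i))"
  have int: "integrable M (\<lambda>t. \<Sum>i<r. w i * (ln (e t i) - mean_log i))"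
    by (intro Bochner_Integration.integrable_sum integrable_mult_right
        Bochner_Integration.integrable_diff integrable_ln_e) auto
  show ?thesis
  proof (intro exI[of _ ?a] conjI allI)
    show "integrable M ?a"
      by (intro Bochner_Integration.integrable_add int) auto
    show "?a t \<le> F (\<lambda>i. ln (e t i))" for t by (rule w)
    have "(\<integral>t. (\<Sum>i<r. w i * (ln (e t i) - mean_log i)) \<partial>M)
        = (\<Sum>i<r. \<integral>t. w i * (ln (e t i) - mean_log i) \<partial>M)"
      using integrable_ln_e by (intro Bochner_Integration.integral_sum) auto
    also have "\<dots> = 0"
      using integrable_ln_e by (intro sum.neutral) (auto simp: mean_log_def prob_space)
    finally have zero: "(\<integral>t. (\<Sum>i<r. w i * (ln (e t i) - mean_log i)) \<partial>M) = 0" .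
    show "(\<integral>t. ?a t \<partial>M) = F (\<lambda>i. ln (c i))"
      unfolding Bochner_Integration.integral_add[OF integrable_const int] zero
      by (simp add: prob_space)
  qed
qed

lemma log_majorized_imp_log_mean_bound:
  assumes maj: log_majorized
  shows log_mean_bound
  unfolding log_mean_bound_def
proof (intro allI impI, elim conjE)
  fix f :: "real \<Rightarrow> real" and \<rho>
  assume f: "\<forall>x>0. 0 \<le> f x" "log_exp_convex f" and \<rho>: "sym_gauge n \<rho>"
  show "ereal (gauge_fun \<rho> n r f c) \<le> eexp (ext_int M (\<lambda>t. elog (gauge_fun \<rho> n r f (e t))))"
  \<comment> \<open>If f has a zero it vanishes at all eigenvalues of \<open>C\<close>, and the left
    side is 0, as it is for r = 0. Otherwise the logarithm of f is finite and the gauges are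
    positive.\<close>
  proof (cases "r = 0 \<or> (\<exists>x>0. f x = 0)")
    case True
    then have "f (c i) = 0" if "i < r" for i
      using that log_exp_convex_zero[of f _ "c i"] f c_pos[OF that] by blast
    then have "gauge_fun \<rho> n r f c = 0" by (rule gauge_fun_zero[OF \<rho>])
    then show ?thesis by (simp add: eexp_nonneg flip: zero_ereal_def)
  next
    case False
    then have r: "0 < r" and nz: "\<And>x. 0 < x \<Longrightarrow> f x \<noteq> 0" by auto
    have f_pos: "0 < f x" if "0 < x" for x
      using f(1) nz[OF that] that by (simp add: order_less_le)
    let ?h = "\<lambda>u. ln (f (exp u))"
    let ?F = "\<lambda>x. ln (gauge_fun \<rho> n r (\<lambda>u. exp (?h u)) x)"
    have F: "coord_convex ?F"
      by (rule coord_convex_ln_gauge_fun[OF \<rho> r r_le convex_on_ln_of_log_exp_convex[OF f_pos f(2)]])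
    have "\<exists>a. integrable M a \<and> (\<forall>t. a t \<le> ?F (\<lambda>i. ln (e t i))) \<and> (\<integral>t. a t \<partial>M) = ?F (\<lambda>i. ln (c i))"
    proof (rule log_majorized_minorant[OF maj F])
      show "?F (\<lambda>i. y (p i)) = ?F y" if "p permutes {..<r}" for p y
        by (rule arg_cong[of _ _ ln], rule gauge_fun_permute[OF \<rho> r_le that])
      show "?F y = ?F z" if "\<And>i. i < r \<Longrightarrow> y i = z i" for y z
        by (rule arg_cong[of _ _ ln], rule gauge_fun_cong) (simp add: that)
    qed
    then obtain a where a: "integrable M a" "\<And>t. a t \<le> ?F (\<lambda>i. ln (e t i))" "(\<integral>t. a t \<partial>M) = ?F (\<lambda>i. ln (c i))"
      by blast
    have c: "gauge_fun \<rho> n r (\<lambda>u. exp (?h u)) (\<lambda>i. ln (c i)) = gauge_fun \<rho> n r f c"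
      using c_pos f_pos by (intro gauge_fun_cong) auto
    have e: "gauge_fun \<rho> n r (\<lambda>u. exp (?h u)) (\<lambda>i. ln (e t i)) = gauge_fun \<rho> n r f (e t)" for t
      using e_pos f_pos by (intro gauge_fun_cong) auto
    have pos: "0 < gauge_fun \<rho> n r f c" "0 < gauge_fun \<rho> n r f (e t)" for t
      using c_pos e_pos f_pos r by (auto intro!: gauge_fun_pos[OF \<rho> r r_le])
    have "ereal (gauge_fun \<rho> n r f c) = eexp (ext_int M (\<lambda>t. ereal (a t)))"
      using pos(1) by (simp add: ext_int_ereal[OF a(1)] a(3) c)
    \<comment> \<open>Only a pointwise comparison is needed: \<open>ext_int\<close> is monotone on
      arbitrary functions, so the gauge may be any function of t.\<close>
    moreover have "ereal (a t) \<le> elog (gauge_fun \<rho> n r f (e t))" for t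
      using a(2)[of t] pos(2)[of t] by (simp add: elog_pos e)
    then have "ext_int M (\<lambda>t. ereal (a t)) \<le> ext_int M (\<lambda>t. elog (gauge_fun \<rho> n r f (e t)))"
      by (rule ext_int_mono)
    ultimately show ?thesis by (simp add: eexp_mono)
  qed
qed

lemma log_majorized_imp_mean_bound:
  assumes maj: log_majorized
  shows mean_bound
  unfolding mean_bound_def
proof (intro allI impI, elim conjE)
  fix g :: "real \<Rightarrow> real" and \<rho>
  assume g: "\<forall>x>0. 0 \<le> g x" "convex_on UNIV (\<lambda>x. g (exp x))" and \<rho>: "sym_gauge n \<rho>"
  let ?F = "gauge_fun \<rho> n r (\<lambda>u. g (exp u))"
  have F: "coord_convex ?F" using g by (intro coord_convex_gauge_fun[OF \<rho>]) auto
  have "\<exists>a. integrable M a \<and> (\<forall>t. a t \<le> ?F (\<lambda>i. ln (e t i))) \<and> (\<integral>t. a t \<partial>M) = ?F (\<lambda>i. ln (c i))"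
  proof (rule log_majorized_minorant[OF maj F])
    show "?F (\<lambda>i. y (p i)) = ?F y" if "p permutes {..<r}" for p y
      by (rule gauge_fun_permute[OF \<rho> r_le that])
    show "?F y = ?F z" if "\<And>i. i < r \<Longrightarrow> y i = z i" for y z
      by (rule gauge_fun_cong) (simp add: that)
  qed
  then obtain a where a: "integrable M a" "\<And>t. a t \<le> ?F (\<lambda>i. ln (e t i))" "(\<integral>t. a t \<partial>M) = ?F (\<lambda>i. ln (c i))"
    by blast
  have c: "?F (\<lambda>i. ln (c i)) = gauge_fun \<rho> n r g c"
    using c_pos by (intro gauge_fun_cong) auto
  have e: "?F (\<lambda>i. ln (e t i)) = gauge_fun \<rho> n r g (e t)" for t
    using e_pos by (intro gauge_fun_cong) auto
  \<comment> \<open>The minorant may be negative. Its positive part has at least the same integral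
    and still lies below the nonnegative gauge.\<close>
  have "ennreal (gauge_fun \<rho> n r g c) \<le> ennreal (\<integral>t. max 0 (a t) \<partial>M)"
    unfolding c[symmetric] a(3)[symmetric] using a(1) by (intro ennreal_leI integral_mono) auto
  also have "\<dots> = (\<integral>\<^sup>+t. ennreal (max 0 (a t)) \<partial>M)"
    using a(1) by (intro nn_integral_eq_integral[symmetric]) auto
  also have "\<dots> \<le> (\<integral>\<^sup>+t. ennreal (gauge_fun \<rho> n r g (e t)) \<partial>M)"
    using a(2) gauge_fun_nonneg[OF \<rho>] by (intro nn_integral_mono ennreal_leI) (auto simp: e)
  finally show "ennreal (gauge_fun \<rho> n r g c) \<le> (\<integral>\<^sup>+t. ennreal (gauge_fun \<rho> n r g (e t)) \<partial>M)" .
qed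

text \<open>A nonnegative exponent keeps the decreasing order, zero padding included. A negative one
  reverses it on the positive part, and the prefix is a largest sum only when it takes in that whole
  part.\<close>

lemma gauge_fun_ky_fan_powr:
  assumes a: "\<And>i. i < r \<Longrightarrow> 0 < a i" "\<And>i j. i \<le> j \<Longrightarrow> j < r \<Longrightarrow> a j \<le> a i"
    and k: "k \<le> r" and q: "0 \<le> q \<or> k = r"
  shows "gauge_fun (ky_fan k) n r (\<lambda>x. x powr q) a = (\<Sum>i<k. a i powr q)"
proof -
  let ?b = "\<lambda>i. if i < r then a i powr q else 0"
  have "gauge_fun (ky_fan k) n r (\<lambda>x. x powr q) a = (\<Sum>i<k. ?b i)"
    unfolding gauge_fun_def
  proof (rule ky_fan_eq_prefix_sum)
    show "k \<le> n" using k r_le by simp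
    show "0 \<le> ?b i" for i by simp
    fix S assume S: "S \<subseteq> {..<n}" "card S = k"
    show "(\<Sum>i\<in>S. ?b i) \<le> (\<Sum>i<k. ?b i)"
    proof (cases "k = r")
      case True
      have "(\<Sum>i\<in>S. ?b i) \<le> (\<Sum>i<n. ?b i)" using S by (intro sum_mono2) auto
      also have "\<dots> = (\<Sum>i<r. ?b i)" using r_le by (intro sum.mono_neutral_right) auto
      finally show ?thesis by (simp add: True)
    next
      case False
      with q have "0 \<le> q" by simp
      then have "?b j \<le> ?b i" if "i \<le> j" for i j
        using that a(1)[of j] a(2)[of i j] by (auto intro: powr_mono2)
      then show ?thesis using S by (intro subset_sum_le_top_sum[of n]) auto
    qed
  qed
  then show ?thesis using k by simp
qed

lemma powr_test_function:
  fixes q :: real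
  shows "continuous_on {0<..} (\<lambda>x::real. x powr q)" "\<forall>x>0. 0 \<le> x powr q"
    "log_exp_convex (\<lambda>x. x powr q)" "convex_on UNIV (\<lambda>x. exp x powr q)"
proof -
  show "continuous_on {0<..} (\<lambda>x::real. x powr q)" by (intro continuous_intros) auto
  show "\<forall>x>0. 0 \<le> x powr q" by simp
  show "log_exp_convex (\<lambda>x. x powr q)"
    unfolding log_exp_convex_def by (auto simp: elog_pos ln_powr algebra_simps)
  show "convex_on UNIV (\<lambda>x. exp x powr q)"
  proof (rule convex_onI)
    fix t x y :: real assume "0 < t" "t < 1"
    then show "exp ((1 - t) *\<^sub>R x + t *\<^sub>R y) powr q \<le> (1 - t) * exp x powr q + t * exp y powr q"
      using exp_convex_combination[of "1 - t" "q * x" "q * y"] by (simp add: powr_def algebra_simps)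
  qed simp
qed

lemma log_majorizedI:
  assumes le: "\<And>k q. 0 < k \<Longrightarrow> k \<le> r \<Longrightarrow> 0 < q \<or> k = r \<Longrightarrow> q \<noteq> 0 \<Longrightarrow> \<bar>q\<bar> \<le> 1 \<Longrightarrow>
      (\<Sum>i<k. c i powr q) \<le> (\<integral>t. (\<Sum>i<k. e t i powr q) \<partial>M)"
  shows log_majorized
proof -
  have upper: "(\<Sum>i<k. ln (c i)) \<le> (\<Sum>i<k. mean_log i)" if k: "k \<le> r" for k
    unfolding mean_log_def
  proof (rule powr_sums_imp_ln_sums)
    show "(\<Sum>i<k. c i powr p) \<le> (\<integral>t. (\<Sum>i<k. e t i powr p) \<partial>M)" if "0 < p" "p \<le> 1" for p
      using le[of k p] that k by (cases "k = 0") auto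
  qed (use k c_pos e_pos integrable_e integrable_ln_e integrable_powr_e in auto)
  \<comment> \<open>The reverse inequality at r: negative exponents are positive exponents of the
    reciprocals, whose logarithms change sign.\<close>
  have "(\<Sum>i<r. ln (inverse (c i))) \<le> (\<Sum>i<r. \<integral>t. ln (inverse (e t i)) \<partial>M)"
  proof (rule powr_sums_imp_ln_sums)
    have inv: "inverse x powr p = x powr (- p)" if "0 < x" for x p :: real
      using that by (simp add: powr_minus inverse_powr)
    show "integrable M (\<lambda>t. inverse (e t i) powr p)" if "i < r" "0 < p" "p \<le> 1" for i p
      using integrable_powr_e[OF that(1), of "- p"] that e_pos[OF that(1)] by (simp add: inv)
    show "(\<Sum>i<r. inverse (c i) powr p) \<le> (\<integral>t. (\<Sum>i<r. inverse (e t i) powr p) \<partial>M)"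
      if "0 < p" "p \<le> 1" for p
      using le[of r "- p"] that c_pos e_pos by (cases "r = 0") (simp_all add: inv)
    show "integrable M (\<lambda>t. ln (inverse (e t i)))" if "i < r" for i
      using integrable_ln_e[OF that] e_pos[OF that] by (simp add: ln_inverse)
  qed (use c_pos e_pos integrable_inverse_e in auto)
  then have "(\<Sum>i<r. mean_log i) \<le> (\<Sum>i<r. ln (c i))"
    using c_pos e_pos by (simp add: ln_inverse mean_log_def sum_negf)
  with upper show ?thesis by (auto simp: log_majorized_def intro: antisym)
qed

lemma mean_bound_imp_log_majorized:
  assumes mean_bound
  shows log_majorized
proof (rule log_majorizedI)
  fix k :: nat and q :: real assume k: "0 < k" "k \<le> r" and q: "0 < q \<or> k = r" "q \<noteq> 0" "\<bar>q\<bar> \<le> 1"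
  have \<rho>: "sym_gauge n (ky_fan k)" using k r_le by (intro sym_gauge_ky_fan) auto
  have q': "0 \<le> q \<or> k = r" using q by auto
  have "ennreal (gauge_fun (ky_fan k) n r (\<lambda>x. x powr q) c)
      \<le> (\<integral>\<^sup>+t. ennreal (gauge_fun (ky_fan k) n r (\<lambda>x. x powr q) (e t)) \<partial>M)"
    using assms \<rho> powr_test_function unfolding mean_bound_def by blast
  then have "ennreal (\<Sum>i<k. c i powr q) \<le> (\<integral>\<^sup>+t. ennreal (\<Sum>i<k. e t i powr q) \<partial>M)"
    by (simp add: gauge_fun_ky_fan_powr[OF c_pos c_antimono k(2) q'] gauge_fun_ky_fan_powr[OF e_pos e_antimono k(2) q'])
  also have "\<dots> = ennreal (\<integral>t. (\<Sum>i<k. e t i powr q) \<partial>M)"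
    using integrable_powr_e k q by (intro nn_integral_eq_integral) (auto intro!: sum_nonneg)
  finally show "(\<Sum>i<k. c i powr q) \<le> (\<integral>t. (\<Sum>i<k. e t i powr q) \<partial>M)"
    by (subst (asm) ennreal_le_iff) (auto intro!: integral_nonneg_AE sum_nonneg)
qed

lemma log_mean_bound_imp_log_majorized:
  assumes log_mean_bound
  shows log_majorized
proof (rule log_majorizedI)
  fix k :: nat and q :: real assume k: "0 < k" "k \<le> r" and q: "0 < q \<or> k = r" "q \<noteq> 0" "\<bar>q\<bar> \<le> 1"
  have \<rho>: "sym_gauge n (ky_fan k)" using k r_le by (intro sym_gauge_ky_fan) auto
  have q': "0 \<le> q \<or> k = r" using q by auto
  let ?S = "\<lambda>t. \<Sum>i<k. e t i powr q"
  have e0: "0 < e t 0" for t using e_pos[of 0 t] k by simp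
  have S_pos: "0 < ?S t" and S_ge: "e t 0 powr q \<le> ?S t" for t
  proof -
    show ge: "e t 0 powr q \<le> ?S t" using k by (intro member_le_sum) auto
    have "0 < e t 0 powr q" using e0[of t] by simp
    with ge show "0 < ?S t" by linarith
  qed
  have S_int: "integrable M ?S"
    using k q by (intro Bochner_Integration.integrable_sum integrable_powr_e) auto
  \<comment> \<open>From above \<open>ln\<close> is at most the sum minus 1; from below the first
    summand alone gives \<open>q * ln (e t 0)\<close>.\<close>
  have "integrable M (\<lambda>t. ln (?S t))"
  proof (rule Bochner_Integration.integrable_bound)
    show "integrable M (\<lambda>t. ?S t + \<bar>ln (e t 0)\<bar>)"
      using S_int integrable_ln_e[of 0] k by (intro Bochner_Integration.integrable_add integrable_abs) auto
    show "(\<lambda>t. ln (?S t)) \<in> borel_measurable M" using borel_measurable_integrable[OF S_int] by measurable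
    show "AE t in M. norm (ln (?S t)) \<le> norm (?S t + \<bar>ln (e t 0)\<bar>)"
    proof (rule AE_I2)
      fix t
      have "q * ln (e t 0) = ln (e t 0 powr q)" using e0[of t] by (simp add: ln_powr)
      also have "\<dots> \<le> ln (?S t)"
        using S_ge[of t] S_pos[of t] e0[of t] by (subst ln_le_cancel_iff) auto
      finally have "- \<bar>q * ln (e t 0)\<bar> \<le> ln (?S t)" by linarith
      moreover have "\<bar>q * ln (e t 0)\<bar> \<le> 1 * \<bar>ln (e t 0)\<bar>"
        unfolding abs_mult using q by (intro mult_right_mono) auto
      moreover have "ln (?S t) \<le> ?S t - 1" by (rule ln_le_minus_one[OF S_pos])
      ultimately show "norm (ln (?S t)) \<le> norm (?S t + \<bar>ln (e t 0)\<bar>)"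
        using S_pos[of t] unfolding real_norm_def by linarith
    qed
  qed
  moreover have "ereal (\<Sum>i<k. c i powr q) \<le> eexp (ext_int M (\<lambda>t. elog (?S t)))"
  proof -
    have "ereal (gauge_fun (ky_fan k) n r (\<lambda>x. x powr q) c)
        \<le> eexp (ext_int M (\<lambda>t. elog (gauge_fun (ky_fan k) n r (\<lambda>x. x powr q) (e t))))"
      using assms \<rho> powr_test_function unfolding log_mean_bound_def by blast
    then show ?thesis
      by (simp add: gauge_fun_ky_fan_powr[OF c_pos c_antimono k(2) q'] gauge_fun_ky_fan_powr[OF e_pos e_antimono k(2) q'])
  qed
  ultimately show "(\<Sum>i<k. c i powr q) \<le> (\<integral>t. ?S t \<partial>M)"
    by (intro le_integral_of_le_exp_ext_int S_pos S_int)
qed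

theorem log_majorization_equivalences:
  shows "log_majorized \<longleftrightarrow> log_mean_bound" and "log_mean_bound \<longleftrightarrow> mean_bound"
  using log_majorized_imp_log_mean_bound log_mean_bound_imp_log_majorized
    log_majorized_imp_mean_bound mean_bound_imp_log_majorized by blast+

text \<open>Positivity and integrability turn the extended logarithms, integrals and exponentials
  into ordinary ones. The empty prefix, present on one side only, holds trivially.\<close>

lemma log_majorized_iff_prod:
  "log_majorized \<longleftrightarrow>
     (\<forall>k\<in>{1..r}. (\<Prod>i<k. ereal (c i)) \<le> (\<Prod>i<k. eexp (ext_int M (\<lambda>t. elog (e t i)))))
     \<and> (\<Prod>i<r. ereal (c i)) = (\<Prod>i<r. eexp (ext_int M (\<lambda>t. elog (e t i))))"
proof -
  have l: "(\<Prod>i<k. ereal (c i)) = ereal (exp (\<Sum>i<k. ln (c i)))" if "k \<le> r" for k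
    using that c_pos by (simp add: prod_ereal exp_sum)
  have "eexp (ext_int M (\<lambda>t. elog (e t i))) = ereal (exp (mean_log i))" if "i < r" for i
    using e_pos[OF that] by (simp add: elog_pos ext_int_ereal[OF integrable_ln_e[OF that]] mean_log_def)
  then have R: "(\<Prod>i<k. eexp (ext_int M (\<lambda>t. elog (e t i)))) = ereal (exp (\<Sum>i<k. mean_log i))"
    if "k \<le> r" for k
    using that by (simp add: prod_ereal exp_sum)
  have "(\<forall>k\<le>r. (\<Sum>i<k. ln (c i)) \<le> (\<Sum>i<k. mean_log i))
      \<longleftrightarrow> (\<forall>k\<in>{1..r}. (\<Sum>i<k. ln (c i)) \<le> (\<Sum>i<k. mean_log i))"
  proof safe
    fix k assume "\<forall>k\<in>{1..r}. (\<Sum>i<k. ln (c i)) \<le> (\<Sum>i<k. mean_log i)" "k \<le> r"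
    then show "(\<Sum>i<k. ln (c i)) \<le> (\<Sum>i<k. mean_log i)" by (cases "k = 0") auto
  qed auto
  then show ?thesis by (simp add: log_majorized_def l R)
qed

end

section \<open>Transfer to tensors\<close>

theorem theorem3p4:
  fixes d :: "nat list" and M :: "'a::metric_space measure"
    and C :: tensor and D :: "'a \<Rightarrow> tensor" and r :: nat
  assumes dims: "\<forall>I\<in>set d. 0 < I"
    and sigma_compact: "sigma_compact_space TYPE('a)"
    and prob: "prob_space M" and borel: "sets M = sets borel"
    and C_nonneg: "nonneg_herm d C"
    and D_nonneg: "\<forall>\<tau>. nonneg_herm d (D \<tau>)"
    and D_cont: "\<forall>i j. continuous_on UNIV (\<lambda>\<tau>. D \<tau> i j)"
    and D_bdd: "bdd_above (range (\<lambda>\<tau>. op_norm d (D \<tau>)))"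
    and C_rank: "hermitian_rank d C = r"
    and D_rank: "\<forall>\<tau>. hermitian_rank d (D \<tau>) = r"
    and D_inv_int: "\<forall>\<rho> p. sym_gauge (card (MI d)) \<rho> \<and> 0 < p \<longrightarrow>
         (\<integral>\<^sup>+\<tau>. ennreal (ui_norm d \<rho> (tfun d (\<lambda>x. x powr (- p)) (D \<tau>))) \<partial>M) < \<infinity>"
  shows
   "(((\<forall>k\<in>{1..r}. (\<Prod>i<k. ereal (herm_eigs d C ! i))
                  \<le> (\<Prod>i<k. eexp (ext_int M (\<lambda>\<tau>. elog (herm_eigs d (D \<tau>) ! i))))) \<and>
     (\<Prod>i<r. ereal (herm_eigs d C ! i))
                  = (\<Prod>i<r. eexp (ext_int M (\<lambda>\<tau>. elog (herm_eigs d (D \<tau>) ! i)))))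
    \<longleftrightarrow>
    (\<forall>f \<rho>. continuous_on {0<..} f \<and> (\<forall>x>0. 0 \<le> f x) \<and> log_exp_convex f
            \<and> sym_gauge (card (MI d)) \<rho> \<longrightarrow>
       ereal (ui_norm d \<rho> (tfun d f C))
         \<le> eexp (ext_int M (\<lambda>\<tau>. elog (ui_norm d \<rho> (tfun d f (D \<tau>)))))))
   \<and>
   ((\<forall>f \<rho>. continuous_on {0<..} f \<and> (\<forall>x>0. 0 \<le> f x) \<and> log_exp_convex f
            \<and> sym_gauge (card (MI d)) \<rho> \<longrightarrow>
       ereal (ui_norm d \<rho> (tfun d f C))
         \<le> eexp (ext_int M (\<lambda>\<tau>. elog (ui_norm d \<rho> (tfun d f (D \<tau>))))))
    \<longleftrightarrow>
    (\<forall>g \<rho>. continuous_on {0<..} g \<and> (\<forall>x>0. 0 \<le> g x) \<and> convex_on UNIV (\<lambda>x. g (exp x))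
            \<and> sym_gauge (card (MI d)) \<rho> \<longrightarrow>
       ennreal (ui_norm d \<rho> (tfun d g C))
         \<le> (\<integral>\<^sup>+\<tau>. ennreal (ui_norm d \<rho> (tfun d g (D \<tau>))) \<partial>M)))"
proof -
  let ?n = "card (MI d)" and ?c = "\<lambda>i. herm_eigs d C ! i" and ?e = "\<lambda>\<tau> i. herm_eigs d (D \<tau>) ! i"
  interpret prob_space M by (rule prob)
  note C_spec = nonneg_herm_rank[OF C_nonneg C_rank]
  note D_spec = nonneg_herm_rank[OF D_nonneg[rule_format] D_rank[rule_format]]
  have D_herm: "hermitian d (D \<tau>)" for \<tau> using D_nonneg by (simp add: nonneg_herm_def)
  have ui_C: "ui_norm d \<rho> (tfun d f C) = gauge_fun \<rho> ?n r f ?c"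
    and ui_D: "ui_norm d \<rho> (tfun d f (D \<tau>)) = gauge_fun \<rho> ?n r f (?e \<tau>)"
    if "sym_gauge ?n \<rho>" "\<forall>x>0. 0 \<le> f x" for \<rho> f \<tau>
    using ui_norm_tfun_rank[OF that(1) C_nonneg C_rank, of f]
      ui_norm_tfun_rank[OF that(1) D_nonneg[rule_format] D_rank[rule_format], of f \<tau>] that(2)
    by (simp_all add: gauge_fun_def)
  have meas: "(\<lambda>\<tau>. ?e \<tau> i) \<in> borel_measurable M" if "i < ?n" for i
  proof -
    have "continuous_on UNIV (\<lambda>\<tau>. ?e \<tau> i)"
      using D_cont that by (intro continuous_on_herm_eigs D_herm) auto
    then have "(\<lambda>\<tau>. ?e \<tau> i) \<in> borel_measurable borel"
      by (rule borel_measurable_continuous_onI)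
    then show ?thesis by (simp add: measurable_cong_sets[OF borel refl])
  qed
  obtain B where B: "op_norm d (D \<tau>) \<le> B" for \<tau>
    using D_bdd unfolding bdd_above_def by auto
  \<comment> \<open>The norm bound makes the eigenvalues integrable, the inverse power condition
    their reciprocals; from here on only the spectra matter.\<close>
  interpret positive_spectra M ?n r ?c ?e
  proof unfold_locales
    show "integrable M (\<lambda>\<tau>. ?e \<tau> i)" if "i < r" for i
    proof (rule integrable_const_bound[where B = B])
      have i: "i < ?n" using that C_spec(1) by simp
      show "AE \<tau> in M. norm (?e \<tau> i) \<le> B"
      proof (rule AE_I2)
        fix \<tau>
        have "?e \<tau> i \<le> op_norm d (D \<tau>)" by (rule herm_eigs_le_op_norm[OF D_herm i])
        then show "norm (?e \<tau> i) \<le> B" using B[of \<tau>] D_spec(2)[OF that, of \<tau>] by simp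
      qed
      show "(\<lambda>\<tau>. ?e \<tau> i) \<in> borel_measurable M" by (rule meas[OF i])
    qed
    show "integrable M (\<lambda>\<tau>. inverse (?e \<tau> i))" if i: "i < r" for i
    proof (rule integrableI_bounded)
      have n: "i < ?n" using i C_spec(1) by simp
      show "(\<lambda>\<tau>. inverse (?e \<tau> i)) \<in> borel_measurable M"
        by (intro borel_measurable_inverse meas[OF n])
      \<comment> \<open>\<open>ky_fan 1\<close> is the largest absolute entry, so with p = 1 its
        norm of the inverse dominates the reciprocal of every positive eigenvalue.\<close>
      have \<rho>: "sym_gauge ?n (ky_fan 1)" using n by (intro sym_gauge_ky_fan) auto
      have "norm (inverse (?e \<tau> i)) \<le> ui_norm d (ky_fan 1) (tfun d (\<lambda>x. x powr (- 1)) (D \<tau>))" for \<tau>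
      proof -
        let ?x = "map (\<lambda>i. if i < r then ?e \<tau> i powr (- 1) else 0) [0..<?n]"
        have "norm (inverse (?e \<tau> i)) = (\<Sum>j\<in>{i}. \<bar>?x ! j\<bar>)"
          using i n D_spec(2)[OF i, of \<tau>] by (simp add: powr_minus)
        also have "\<dots> \<le> ky_fan 1 ?x" using n by (intro ky_fan_ge) auto
        also have "\<dots> = ui_norm d (ky_fan 1) (tfun d (\<lambda>x. x powr (- 1)) (D \<tau>))"
          by (rule ui_D[OF \<rho>, unfolded gauge_fun_def, symmetric]) simp
        finally show ?thesis .
      qed
      then have "(\<integral>\<^sup>+\<tau>. ennreal (norm (inverse (?e \<tau> i))) \<partial>M)
          \<le> (\<integral>\<^sup>+\<tau>. ennreal (ui_norm d (ky_fan 1) (tfun d (\<lambda>x. x powr (- 1)) (D \<tau>))) \<partial>M)"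
        by (intro nn_integral_mono ennreal_leI)
      also have "\<dots> < \<infinity>" using D_inv_int \<rho> zero_less_one by blast
      finally show "(\<integral>\<^sup>+\<tau>. ennreal (norm (inverse (?e \<tau> i))) \<partial>M) < \<infinity>" .
    qed
  qed (use C_spec D_spec(2) in \<open>auto intro!: herm_eigs_antimono\<close>)
  have ii: "log_mean_bound \<longleftrightarrow>
    (\<forall>f \<rho>. continuous_on {0<..} f \<and> (\<forall>x>0. 0 \<le> f x) \<and> log_exp_convex f \<and> sym_gauge ?n \<rho> \<longrightarrow>
       ereal (ui_norm d \<rho> (tfun d f C)) \<le> eexp (ext_int M (\<lambda>\<tau>. elog (ui_norm d \<rho> (tfun d f (D \<tau>))))))"
    unfolding log_mean_bound_def by (intro iff_allI imp_cong refl) (simp add: ui_C ui_D)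
  have iii: "mean_bound \<longleftrightarrow>
    (\<forall>g \<rho>. continuous_on {0<..} g \<and> (\<forall>x>0. 0 \<le> g x) \<and> convex_on UNIV (\<lambda>x. g (exp x)) \<and> sym_gauge ?n \<rho> \<longrightarrow>
       ennreal (ui_norm d \<rho> (tfun d g C)) \<le> (\<integral>\<^sup>+\<tau>. ennreal (ui_norm d \<rho> (tfun d g (D \<tau>))) \<partial>M))"
    unfolding mean_bound_def by (intro iff_allI imp_cong refl) (simp add: ui_C ui_D)
  show ?thesis
    using log_majorization_equivalences unfolding log_majorized_iff_prod ii iii by (intro conjI)
qed

end
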